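(* (Weighted Zykov's Theorem) Fix integers $2\le q<p$ and $n\ge 1$. Among all $n$-vertex $p$-skeleton-free weighted graphs $R$ for which $\mathcal{N}_q(R)$ is maximum, there is a profile graph.
   Context: A weighted graph is a complete graph on a vertex set in which each pair $uv$ of distinct vertices receives a weight $w(uv)\in\{0,\tfrac12,1\}$ (weight $0$ means a non-edge). A $p$-skeleton in a weighted graph is a pair of vertex sets $(X,Y)$ with $X\subseteq Y$, every pair of vertices in $X$ having weight $1$, every pair of vertices in $Y$ having weight at least $\tfrac12$, and $|X|+|Y|=p$; a weighted graph is $p$-skeleton-free if it contains no $p$-skeleton. The weight of a vertex set $K$ is $w(K)=\prod_{\{u,v\}\subseteq K} w(uv)$, and $\mathcal{N}_q(R)=\sum_{K\in\binom{V(R)}{q}} w(K)$. Given positive integers $t,s_1,\dots,s_t$, a profile graph with profile $(s_1,\dots,s_t)$ is obtained by partitioning the vertex set into $t$ parts (of arbitrary sizes), giving weight $1$ to every pair of vertices in different parts, and, for each $i$, partitioning part $i$ into $s_i$ classes ("cells") whose sizes differ by at most $1$, giving weight $\tfrac12$ to pairs of vertices in part $i$ lying in different cells and weight $0$ to pairs in the same cell. *)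

theory Defs
  imports Complex_Main "HOL-Library.Ramsey" "HOL-Library.Disjoint_Sets"
begin

text \<open>Weights are given to unordered pairs, i.e. to the two-element sets in \<open>[verts R]\<^bsup>2\<^esup>\<close>;
  the values of \<^term>\<open>wt\<close> on all other sets are irrelevant.\<close>

record 'a wgraph =
  verts :: "'a set"
  wt :: "'a set \<Rightarrow> real"

definition weighted_graph :: "'a wgraph \<Rightarrow> bool" where
  "weighted_graph R \<longleftrightarrow> finite (verts R) \<and> (\<forall>e \<in> [verts R]\<^bsup>2\<^esup>. wt R e \<in> {0, 1/2, 1})"

definition is_skeleton :: "nat \<Rightarrow> 'a wgraph \<Rightarrow> 'a set \<Rightarrow> 'a set \<Rightarrow> bool" where
  "is_skeleton p R X Y \<longleftrightarrow>
     X \<subseteq> Y \<and> Y \<subseteq> verts R \<and>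
     (\<forall>e \<in> [X]\<^bsup>2\<^esup>. wt R e = 1) \<and>
     (\<forall>e \<in> [Y]\<^bsup>2\<^esup>. wt R e \<ge> 1/2) \<and>
     card X + card Y = p"

definition skeleton_free :: "nat \<Rightarrow> 'a wgraph \<Rightarrow> bool" where
  "skeleton_free p R \<longleftrightarrow> \<not> (\<exists>X Y. is_skeleton p R X Y)"

definition set_weight :: "'a wgraph \<Rightarrow> 'a set \<Rightarrow> real" where
  "set_weight R K = (\<Prod>e \<in> [K]\<^bsup>2\<^esup>. wt R e)"

definition clique_count :: "nat \<Rightarrow> 'a wgraph \<Rightarrow> real" where
  "clique_count q R = (\<Sum>K \<in> [verts R]\<^bsup>q\<^esup>. set_weight R K)"

text \<open>The profile \<open>(s\<^sub>1, \<dots>, s\<^sub>t)\<close> is the list \<open>s\<close>; parts and cells are indexed from 0, and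
  \<open>C i j\<close> is cell \<open>j\<close> of part \<open>P i\<close>. Parts may be empty, as may cells of a part with fewer vertices
  than cells; dropping the empty ones leaves the same weighted graph, with a smaller profile.\<close>

definition has_profile :: "nat list \<Rightarrow> 'a wgraph \<Rightarrow> bool" where
  "has_profile s R \<longleftrightarrow>
     s \<noteq> [] \<and> (\<forall>i < length s. s ! i > 0) \<and>
     (\<exists>P C.
        disjoint_family_on P {..<length s} \<and> (\<Union>i<length s. P i) = verts R \<and>
        (\<forall>i < length s.
           disjoint_family_on (C i) {..<s ! i} \<and> (\<Union>j<s ! i. C i j) = P i \<and>
           (\<forall>j < s ! i. \<forall>k < s ! i. card (C i j) \<le> card (C i k) + 1)) \<and>
        (\<forall>i < length s. \<forall>j < length s. i \<noteq> j \<longrightarrow>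
           (\<forall>u \<in> P i. \<forall>v \<in> P j. wt R {u, v} = 1)) \<and>
        (\<forall>i < length s. \<forall>j < s ! i. \<forall>k < s ! i. j \<noteq> k \<longrightarrow>
           (\<forall>u \<in> C i j. \<forall>v \<in> C i k. wt R {u, v} = 1/2)) \<and>
        (\<forall>i < length s. \<forall>j < s ! i.
           (\<forall>u \<in> C i j. \<forall>v \<in> C i j. u \<noteq> v \<longrightarrow> wt R {u, v} = 0)))"

definition profile_graph :: "'a wgraph \<Rightarrow> bool" where
  "profile_graph R \<longleftrightarrow> weighted_graph R \<and> (\<exists>s. has_profile s R)"

end

theory Submission
  imports Defs "HOL-Analysis.Convex"
begin

text \<open>By Zykov's symmetrization at weight 0, an optimal graph may be taken to be the blow-up of a graph
  \<open>R\<close> on cells \<open>i\<close> of sizes \<open>x i > 0\<close> in which all weights are \<open>1/2\<close> or 1. For such \<open>R\<close>,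
  skeleton-freeness only bounds the number of cells plus the size of a largest weight-1 clique, so it
  survives when a cell copies the weights of another cell at mutual weight \<open>1/2\<close>. Which of two such
  cells should copy the other is not decided by a linear function, but at an optimum both copies are
  optimal again: for sizes within a factor of 2 because all products of weights are powers of \<open>1/2\<close>,
  and other sizes are excluded by moving a vertex between the cells and the Cauchy-Schwarz inequality.
  An optimum with the largest number of pairs of cells with equal neighbourhoods is then
  complete multipartite in the weight-1 pairs, and optimality of the sizes balances the cells of a
  part.\<close>

section \<open>Vertex-weighted clique counts\<close>

text \<open>The clique count of a blow-up, as a polynomial in the cell sizes \<open>x\<close>. The
  sizes are real so that weights towards a fixed vertex can be absorbed into them.\<close>

definition vcount :: "('a set \<Rightarrow> real) \<Rightarrow> ('a \<Rightarrow> real) \<Rightarrow> nat \<Rightarrow> 'a set \<Rightarrow> real" where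
  "vcount w x q J = (\<Sum>K\<in>[J]\<^bsup>q\<^esup>. (\<Prod>k\<in>K. x k) * (\<Prod>e\<in>[K]\<^bsup>2\<^esup>. w e))"

lemma clique_count_eq_vcount: "clique_count q R = vcount (wt R) (\<lambda>_. 1) q (verts R)"
  by (simp add: clique_count_def set_weight_def vcount_def)

lemma nsets_2_insert:
  assumes "i \<notin> K"
  shows "[insert i K]\<^bsup>2\<^esup> = [K]\<^bsup>2\<^esup> \<union> (\<lambda>k. {i,k}) ` K" "[K]\<^bsup>2\<^esup> \<inter> (\<lambda>k. {i,k}) ` K = {}"
    "inj_on (\<lambda>k. {i,k}) K"
  using assms by (auto simp: nsets_2_eq inj_on_def doubleton_eq_iff)

lemma nsets_Suc_insert:
  assumes "i \<notin> J"
  shows "[insert i J]\<^bsup>Suc q\<^esup> = [J]\<^bsup>Suc q\<^esup> \<union> insert i ` [J]\<^bsup>q\<^esup>" "[J]\<^bsup>Suc q\<^esup> \<inter> insert i ` [J]\<^bsup>q\<^esup> = {}"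
    "inj_on (insert i) ([J]\<^bsup>q\<^esup>)"
proof -
  show "[insert i J]\<^bsup>Suc q\<^esup> = [J]\<^bsup>Suc q\<^esup> \<union> insert i ` [J]\<^bsup>q\<^esup>" (is "?L = ?R")
  proof
    show "?L \<subseteq> ?R"
    proof
      fix K assume K: "K \<in> ?L"
      show "K \<in> ?R"
      proof (cases "i \<in> K")
        case True
        then have "K = insert i (K - {i})" "K - {i} \<in> [J]\<^bsup>q\<^esup>"
          using K by (auto simp: nsets_def)
        then show ?thesis by blast
      qed (use K in \<open>auto simp: nsets_def\<close>)
    qed
    show "?R \<subseteq> ?L"
    proof -
      have "card (insert i K) = Suc q" if "K \<subseteq> J" "finite K" "card K = q" for K
        using that assms by (subst card_insert_disjoint) auto
      then show ?thesis by (auto simp: nsets_def)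
    qed
  qed
  show "[J]\<^bsup>Suc q\<^esup> \<inter> insert i ` [J]\<^bsup>q\<^esup> = {}" using assms by (auto simp: nsets_def)
  show "inj_on (insert i) ([J]\<^bsup>q\<^esup>)"
    using assms by (force simp: inj_on_def nsets_def)
qed

text \<open>Splits the sets by whether they contain \<open>i\<close>; in those that do, the factor
  \<open>w {i,k}\<close> moves into the size of \<open>k\<close>.\<close>

lemma vcount_insert:
  assumes "finite J" "i \<notin> J"
  shows "vcount w x (Suc q) (insert i J)
    = vcount w x (Suc q) J + x i * vcount w (\<lambda>k. x k * w {i,k}) q J"
proof -
  define h where "h K = (\<Prod>k\<in>K. x k) * (\<Prod>e\<in>[K]\<^bsup>2\<^esup>. w e)" for K
  have "vcount w x (Suc q) (insert i J) = sum h ([J]\<^bsup>Suc q\<^esup>) + sum h (insert i ` [J]\<^bsup>q\<^esup>)"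
    using assms unfolding vcount_def h_def[symmetric]
    by (simp add: nsets_Suc_insert sum.union_disjoint finite_imp_finite_nsets)
  also have "sum h (insert i ` [J]\<^bsup>q\<^esup>) = (\<Sum>K\<in>[J]\<^bsup>q\<^esup>. h (insert i K))"
    using assms by (simp add: sum.reindex nsets_Suc_insert)
  also have "\<dots> = (\<Sum>K\<in>[J]\<^bsup>q\<^esup>. x i * ((\<Prod>k\<in>K. x k * w {i,k}) * (\<Prod>e\<in>[K]\<^bsup>2\<^esup>. w e)))"
  proof (rule sum.cong)
    fix K assume "K \<in> [J]\<^bsup>q\<^esup>"
    then have K: "finite K" "i \<notin> K" using assms by (auto simp: nsets_def)
    have "(\<Prod>e\<in>[insert i K]\<^bsup>2\<^esup>. w e) = (\<Prod>e\<in>[K]\<^bsup>2\<^esup>. w e) * (\<Prod>k\<in>K. w {i,k})"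
      using K by (simp add: nsets_2_insert prod.union_disjoint finite_imp_finite_nsets prod.reindex)
    then show "h (insert i K) = x i * ((\<Prod>k\<in>K. x k * w {i,k}) * (\<Prod>e\<in>[K]\<^bsup>2\<^esup>. w e))"
      using K by (simp add: h_def prod.distrib)
  qed simp
  finally show ?thesis by (simp add: vcount_def h_def sum_distrib_left)
qed

lemma vcount_cong:
  assumes "\<And>k. k \<in> J \<Longrightarrow> x k = y k" "\<And>e. e \<in> [J]\<^bsup>2\<^esup> \<Longrightarrow> w e = v e"
  shows "vcount w x q J = vcount v y q J"
  unfolding vcount_def
proof (rule sum.cong)
  fix K assume "K \<in> [J]\<^bsup>q\<^esup>"
  then have "K \<subseteq> J" "[K]\<^bsup>2\<^esup> \<subseteq> [J]\<^bsup>2\<^esup>" by (auto simp: nsets_def)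
  then show "(\<Prod>k\<in>K. x k) * (\<Prod>e\<in>[K]\<^bsup>2\<^esup>. w e) = (\<Prod>k\<in>K. y k) * (\<Prod>e\<in>[K]\<^bsup>2\<^esup>. v e)"
    using assms by (intro arg_cong2[where f="(*)"] prod.cong) auto
qed simp

text \<open>The count is quadratic in the sizes of any two vertices, with coefficients free of both
  sizes; this is the form used to compare different ways of sharing size between two cells.\<close>

lemma vcount_insert2:
  assumes "finite J" "i \<notin> J" "j \<notin> J" "i \<noteq> j"
  shows "vcount w x (Suc (Suc q)) (insert i (insert j J))
    = vcount w x (Suc (Suc q)) J
      + x i * vcount w (\<lambda>k. x k * w {i,k}) (Suc q) J + x j * vcount w (\<lambda>k. x k * w {j,k}) (Suc q) J
      + x i * x j * w {i,j} * vcount w (\<lambda>k. x k * w {i,k} * w {j,k}) q J"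
  using assms by (simp add: vcount_insert algebra_simps)

section \<open>Positivity and inner-product inequalities for the count\<close>

lemma vcount_nonneg:
  assumes "\<And>k. k \<in> J \<Longrightarrow> 0 \<le> x k" "\<And>e. e \<in> [J]\<^bsup>2\<^esup> \<Longrightarrow> 0 \<le> w e"
  shows "0 \<le> vcount w x q J"
  unfolding vcount_def
proof (rule sum_nonneg)
  fix K assume "K \<in> [J]\<^bsup>q\<^esup>"
  then have "K \<subseteq> J" "[K]\<^bsup>2\<^esup> \<subseteq> [J]\<^bsup>2\<^esup>" by (auto simp: nsets_def)
  then show "0 \<le> (\<Prod>k\<in>K. x k) * (\<Prod>e\<in>[K]\<^bsup>2\<^esup>. w e)"
    using assms by (intro mult_nonneg_nonneg prod_nonneg) auto
qed

lemma vcount_pos: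
  assumes "finite J" "\<And>k. k \<in> J \<Longrightarrow> 0 < x k" "\<And>e. e \<in> [J]\<^bsup>2\<^esup> \<Longrightarrow> 0 < w e" "q \<le> card J"
  shows "0 < vcount w x q J"
  unfolding vcount_def
proof (rule sum_pos)
  show "finite ([J]\<^bsup>q\<^esup>)" "[J]\<^bsup>q\<^esup> \<noteq> {}"
    using assms by (auto simp: finite_imp_finite_nsets nsets_eq_empty_iff)
  fix K assume "K \<in> [J]\<^bsup>q\<^esup>"
  then have "K \<subseteq> J" "[K]\<^bsup>2\<^esup> \<subseteq> [J]\<^bsup>2\<^esup>" by (auto simp: nsets_def)
  then show "0 < (\<Prod>k\<in>K. x k) * (\<Prod>e\<in>[K]\<^bsup>2\<^esup>. w e)"
    using assms by (intro mult_pos_pos prod_pos) auto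
qed

text \<open>Exhibits the count as an inner product of the vectors \<open>prod a K\<close> and
  \<open>prod b K\<close>, indexed by the \<open>q\<close>-sets \<open>K\<close>, with a weight on
  each \<open>K\<close> that does not depend on \<open>a\<close> and \<open>b\<close>.\<close>

lemma vcount_mult:
  "vcount w (\<lambda>k. x k * a k * b k) q J
    = (\<Sum>K\<in>[J]\<^bsup>q\<^esup>. (\<Prod>k\<in>K. x k) * (\<Prod>e\<in>[K]\<^bsup>2\<^esup>. w e) * prod a K * prod b K)"
  unfolding vcount_def by (intro sum.cong) (auto simp: prod.distrib)

lemma vcount_Cauchy_Schwarz:
  assumes "\<And>k. k \<in> J \<Longrightarrow> 0 \<le> x k" "\<And>e. e \<in> [J]\<^bsup>2\<^esup> \<Longrightarrow> 0 \<le> w e"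
  shows "(vcount w (\<lambda>k. x k * a k * b k) q J)\<^sup>2
    \<le> vcount w (\<lambda>k. x k * a k * a k) q J * vcount w (\<lambda>k. x k * b k * b k) q J"
proof -
  define P where "P K = (\<Prod>k\<in>K. x k) * (\<Prod>e\<in>[K]\<^bsup>2\<^esup>. w e)" for K
  \<comment> \<open>The square root of the nonnegative weight is given to each of the two vectors,
    which turns the weighted form into a standard inner product.\<close>
  have P: "sqrt (P K) * sqrt (P K) = P K" if "K \<in> [J]\<^bsup>q\<^esup>" for K
  proof -
    have "K \<subseteq> J" "[K]\<^bsup>2\<^esup> \<subseteq> [J]\<^bsup>2\<^esup>" using that by (auto simp: nsets_def)
    then have "0 \<le> P K"
      unfolding P_def using assms by (intro mult_nonneg_nonneg prod_nonneg) auto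
    then show ?thesis by simp
  qed
  have eq: "vcount w (\<lambda>k. x k * f k * g k) q J
      = (\<Sum>K\<in>[J]\<^bsup>q\<^esup>. (sqrt (P K) * prod f K) * (sqrt (P K) * prod g K))" for f g
    unfolding vcount_mult P_def[symmetric]
  proof (rule sum.cong)
    fix K assume "K \<in> [J]\<^bsup>q\<^esup>"
    have "(sqrt (P K) * prod f K) * (sqrt (P K) * prod g K)
      = (sqrt (P K) * sqrt (P K)) * prod f K * prod g K" by (simp only: mult_ac)
    then show "P K * prod f K * prod g K = (sqrt (P K) * prod f K) * (sqrt (P K) * prod g K)"
      using P[OF \<open>K \<in> _\<close>] by simp
  qed simp
  show ?thesis
    unfolding eq using Cauchy_Schwarz_ineq_sum[of "\<lambda>K. sqrt (P K) * prod a K" "\<lambda>K. sqrt (P K) * prod b K"]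
    by (simp add: power2_eq_square)
qed

lemma prod_half_power:
  fixes a :: "'a \<Rightarrow> real"
  assumes "\<And>k. k \<in> K \<Longrightarrow> a k \<in> {1/2, 1}"
  shows "\<exists>m. prod a K = (1/2) ^ m"
  using assms
proof (induction K rule: infinite_finite_induct)
  case (insert k K)
  then obtain m where "prod a K = (1/2) ^ m" by auto
  moreover have "a k = (1/2) ^ 1 \<or> a k = (1/2) ^ 0" using insert by auto
  ultimately show ?case using insert(1,2) by (metis power_add prod.insert)
qed (auto intro: exI[of _ 0])

text \<open>Distinct powers of 1/2 differ by a factor of at least 2, so multipliers within a factor
  of 2 of each other cannot reverse their order: \<open>a - b\<close> and
  \<open>x * a - y * b\<close> never have opposite signs.\<close>

lemma half_power_gap:
  fixes x y :: real
  assumes "0 \<le> x" "0 \<le> y" "x \<le> 2 * y" "y \<le> 2 * x" and a: "a = (1/2) ^ m" and b: "b = (1/2) ^ l"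
  shows "0 \<le> (a - b) * (x * a - y * b)"
proof -
  have gap: "2 * (1/2::real) ^ l' \<le> (1/2) ^ m'" if "m' < l'" for m' l' :: nat
  proof -
    have "(1/2::real) ^ l' \<le> (1/2) ^ Suc m'" using that by (intro power_decreasing) auto
    then show ?thesis by simp
  qed
  consider "m = l" | "m < l" | "l < m" by linarith
  then show ?thesis
  proof cases
    case 2
    have "2 * b \<le> a" "0 \<le> b" using gap[OF 2] a b by auto
    moreover have "y * b \<le> x * (2 * b)" using assms(4) \<open>0 \<le> b\<close> mult_right_mono[of y "2*x" b] by simp
    moreover have "x * (2 * b) \<le> x * a" using \<open>2*b \<le> a\<close> assms(1) by (rule mult_left_mono)
    ultimately show ?thesis by (intro mult_nonneg_nonneg) auto
  next
    case 3
    have "2 * a \<le> b" "0 \<le> a" using gap[OF 3] a b by auto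
    moreover have "x * a \<le> y * (2 * a)" using assms(3) \<open>0 \<le> a\<close> mult_right_mono[of x "2*y" a] by simp
    moreover have "y * (2 * a) \<le> y * b" using \<open>2*a \<le> b\<close> assms(2) by (rule mult_left_mono)
    ultimately show ?thesis by (intro mult_nonpos_nonpos) auto
  qed (use a b in simp)
qed

text \<open>Products of weights \<open>1/2\<close> and \<open>1\<close> are powers of \<open>1/2\<close>, so two different ones differ by
  a factor of at least 2; this makes the quadratic form below nonnegative term by term.\<close>

lemma vcount_half_power_form:
  assumes "\<And>k. k \<in> J \<Longrightarrow> 0 \<le> x k" "\<And>e. e \<in> [J]\<^bsup>2\<^esup> \<Longrightarrow> 0 \<le> w e"
    and ab: "\<And>k. k \<in> J \<Longrightarrow> a k \<in> {1/2, 1} \<and> b k \<in> {1/2, 1}"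
    and uv: "0 \<le> u" "0 \<le> v" "u \<le> 2 * v" "v \<le> 2 * u"
  shows "(u + v) * vcount w (\<lambda>k. x k * a k * b k) q J
    \<le> u * vcount w (\<lambda>k. x k * a k * a k) q J + v * vcount w (\<lambda>k. x k * b k * b k) q J"
proof -
  define P where "P K = (\<Prod>k\<in>K. x k) * (\<Prod>e\<in>[K]\<^bsup>2\<^esup>. w e)" for K
  have "0 \<le> (\<Sum>K\<in>[J]\<^bsup>q\<^esup>. P K * ((prod a K - prod b K) * (u * prod a K - v * prod b K)))"
  proof (rule sum_nonneg)
    fix K assume "K \<in> [J]\<^bsup>q\<^esup>"
    then have K: "K \<subseteq> J" "[K]\<^bsup>2\<^esup> \<subseteq> [J]\<^bsup>2\<^esup>" by (auto simp: nsets_def)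
    obtain m l where "prod a K = (1/2) ^ m" "prod b K = (1/2) ^ l"
      using prod_half_power[of K a] prod_half_power[of K b] ab K by blast
    then have "0 \<le> (prod a K - prod b K) * (u * prod a K - v * prod b K)"
      using half_power_gap uv by blast
    moreover have "0 \<le> P K"
      unfolding P_def using assms K by (intro mult_nonneg_nonneg prod_nonneg) auto
    ultimately show "0 \<le> P K * ((prod a K - prod b K) * (u * prod a K - v * prod b K))" by simp
  qed
  also have "\<dots> = u * vcount w (\<lambda>k. x k * a k * a k) q J + v * vcount w (\<lambda>k. x k * b k * b k) q J
      - (u + v) * vcount w (\<lambda>k. x k * a k * b k) q J"
    unfolding vcount_mult P_def[symmetric]
    by (simp add: sum_distrib_left sum_subtractf sum.distrib flip: sum_subtractf sum.distrib)
       (intro sum.cong, auto simp: algebra_simps)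
  finally show ?thesis by simp
qed

text \<open>In the two lemmas below, \<open>x\<close> and \<open>y\<close> are the sizes of two cells at mutual weight \<open>1/2\<close>; the
  number of cliques is \<open>c + x fi + y fj + x y gij / 2\<close>, and \<open>gii\<close>, \<open>gjj\<close> replace \<open>gij\<close> when one
  cell copies the weights of the other. If \<open>x \<le> 2 y\<close>, the gains from the two copies, divided by
  \<open>y\<close> and by \<open>x\<close>, have a nonnegative sum, so by optimality both vanish. If \<open>x > 2 y\<close>, comparison
  with the sizes \<open>x - 1, y + 1\<close> bounds \<open>fi - fj\<close> from below and, after copying, \<open>gii\<close> and \<open>gjj\<close>
  from above, which contradicts the Cauchy-Schwarz inequality.\<close>

lemma symmetrization_wlog:
  fixes x y :: nat and c fi fj gii gij gjj M :: real
  assumes pos: "0 < y" "y \<le> x" "0 < gij" "0 \<le> gii" "0 \<le> gjj"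
    and CS: "gij\<^sup>2 \<le> gii * gjj"
    and near: "x \<le> 2 * y \<Longrightarrow> (real x + real y) * gij \<le> x * gii + y * gjj"
    and M: "M = c + x * fi + y * fj + x * y * gij / 2"
    and size: "\<And>a b. a + b = x + y \<Longrightarrow> c + real a * fi + real b * fj + real a * real b * gij / 2 \<le> M"
    and ii: "\<And>a b. a + b = x + y \<Longrightarrow> c + real (a + b) * fi + real a * real b * gii / 2 \<le> M"
    and jj: "\<And>a b. a + b = x + y \<Longrightarrow> c + real (a + b) * fj + real a * real b * gjj / 2 \<le> M"
  shows "c + real (x + y) * fi + real x * real y * gii / 2 = M \<and>
    c + real (x + y) * fj + real x * real y * gjj / 2 = M"
proof (cases "x \<le> 2 * y")
  case True
  define d where "d = fi - fj"
  have x: "0 < real x" "0 < real y" using pos by auto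
  \<comment> \<open>The left side is the gain when the second cell copies the first.\<close>
  have "real y * (d + x * (gii - gij) / 2) \<le> 0"
    using ii[of x y] M by (simp add: d_def algebra_simps) (simp add: field_simps)
  then have 1: "d + x * (gii - gij) / 2 \<le> 0" using x by (simp add: mult_le_0_iff)
  have "real x * (y * (gjj - gij) / 2 - d) \<le> 0"
    using jj[of x y] M by (simp add: d_def algebra_simps) (simp add: field_simps)
  then have 2: "y * (gjj - gij) / 2 - d \<le> 0" using x by (simp add: mult_le_0_iff)
  \<comment> \<open>Here \<open>d\<close> cancels, and half of the inequality \<open>near\<close>
    remains.\<close>
  have "0 \<le> d + x * (gii - gij) / 2 + (y * (gjj - gij) / 2 - d)"
    using near[OF True] by (simp add: field_simps)
  with 1 2 have e: "d + x * (gii - gij) / 2 = 0" "y * (gjj - gij) / 2 - d = 0" by linarith+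
  have "c + real (x + y) * fi + real x * real y * gii / 2 = M + y * (d + x * (gii - gij) / 2)"
    "c + real (x + y) * fj + real x * real y * gjj / 2 = M + x * (y * (gjj - gij) / 2 - d)"
    unfolding M d_def by (simp_all add: field_simps)
  with e show ?thesis by simp
next
  case False
  define X Y where "X = real x" and "Y = real y"
  have XY: "1 \<le> Y" "2 * Y + 1 \<le> X" using False pos(1) by (auto simp: X_def Y_def)
  define D where "D = 2 * (fi - fj)"
  \<comment> \<open>The product of the sizes after one vertex has moved to the smaller cell.\<close>
  define B where "B = (X - 1) * (Y + 1)"
  have s: "(x - 1) + (y + 1) = x + y" and r: "real (x - 1) = X - 1" "real (y + 1) = Y + 1"
    "real (x - 1 + (y + 1)) = X + Y"
    using False by (auto simp: X_def Y_def)
  have M': "M = c + X * fi + Y * fj + X * Y * gij / 2" using M by (simp add: X_def Y_def)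
  have 1: "(X - Y - 1) * gij \<le> D"
    using size[OF s] M' unfolding r D_def by (simp add: field_simps)
  have 2: "B * gii \<le> Y * (X * gij - D)"
    using ii[OF s] M' unfolding r D_def B_def by (simp add: field_simps)
  have 3: "B * gjj \<le> X * (Y * gij + D)"
    using jj[OF s] M' unfolding r D_def B_def by (simp add: field_simps)
  have B: "X * Y < B" "0 < X * Y" using XY by (auto simp: B_def algebra_simps)
  define t where "t = D - (X - Y - 1) * gij"
  have t: "0 \<le> t" using 1 by (simp add: t_def)
  have Dt: "D = (X - Y - 1) * gij + t" by (simp add: t_def)
  \<comment> \<open>The two factors are \<open>(Y + 1) * gij - t\<close> and
    \<open>(X - 1) * gij + t\<close>. The term linear in \<open>t\<close> has the right sign because
    \<open>2 * Y + 1 \<le> X\<close> and \<open>1 \<le> Y\<close> give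
    \<open>0 \<le> X - Y - 2\<close>.\<close>
  have "(X * gij - D) * (Y * gij + D) = B * gij\<^sup>2 - t * gij * (X - Y - 2) - t\<^sup>2"
    unfolding Dt B_def by (simp add: algebra_simps power2_eq_square)
  also have "\<dots> \<le> B * gij\<^sup>2"
  proof -
    have "0 \<le> t * gij * (X - Y - 2)" using t pos XY by (intro mult_nonneg_nonneg) auto
    then show ?thesis using zero_le_power2[of t] by linarith
  qed
  finally have 4: "(X * gij - D) * (Y * gij + D) \<le> B * gij\<^sup>2" .
  \<comment> \<open>The chain ends in a strict inequality of a number with itself: moving a vertex
    to the smaller cell strictly increases the product of the sizes, so
    \<open>X * Y < B\<close>.\<close>
  have "B * (B * gij\<^sup>2) \<le> (B * gii) * (B * gjj)"
    using CS B by (simp add: mult_left_mono algebra_simps)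
  also have "\<dots> \<le> (Y * (X * gij - D)) * (X * (Y * gij + D))"
    by (rule mult_mono'[OF 2 3]) (use B pos in \<open>auto intro!: mult_nonneg_nonneg\<close>)
  also have "\<dots> = X * Y * ((X * gij - D) * (Y * gij + D))" by (simp add: algebra_simps)
  also have "\<dots> \<le> X * Y * (B * gij\<^sup>2)" using 4 B by (intro mult_left_mono) auto
  also have "\<dots> < B * (B * gij\<^sup>2)" using B pos by (intro mult_strict_right_mono) auto
  finally show ?thesis by simp
qed

text \<open>The order of the sizes is removed by exchanging the cells. The exchanged case uses the
  second equality of \<open>symmetrization_wlog\<close>, which is why that lemma concludes
  both.\<close>

lemma symmetrization:
  fixes x y :: nat and c fi fj gii gij gjj M :: real
  assumes pos: "0 < x" "0 < y" "0 < gij" "0 \<le> gii" "0 \<le> gjj"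
    and CS: "gij\<^sup>2 \<le> gii * gjj"
    and near: "x \<le> 2 * y \<Longrightarrow> y \<le> 2 * x \<Longrightarrow> (real x + real y) * gij \<le> x * gii + y * gjj"
    and M: "M = c + x * fi + y * fj + x * y * gij / 2"
    and size: "\<And>a b. a + b = x + y \<Longrightarrow> c + real a * fi + real b * fj + real a * real b * gij / 2 \<le> M"
    and ii: "\<And>a b. a + b = x + y \<Longrightarrow> c + real (a + b) * fi + real a * real b * gii / 2 \<le> M"
    and jj: "\<And>a b. a + b = x + y \<Longrightarrow> c + real (a + b) * fj + real a * real b * gjj / 2 \<le> M"
  shows "c + real (x + y) * fi + real x * real y * gii / 2 = M"
proof (cases "y \<le> x")
  case True
  then show ?thesis
    using symmetrization_wlog[of y x gij gii gjj M c fi fj] assms by simp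
next
  case False
  have sz: "c + real a * fj + real b * fi + real a * real b * gij / 2 \<le> M" if "a + b = y + x" for a b
    using size[of b a] that by (simp add: algebra_simps)
  have "c + real (y + x) * fj + real y * real x * gjj / 2 = M \<and>
    c + real (y + x) * fi + real y * real x * gii / 2 = M"
    by (rule symmetrization_wlog[of x y gij gjj gii M c fj fi])
      (use False assms sz in \<open>auto simp: algebra_simps\<close>)
  then show ?thesis by (simp add: algebra_simps)
qed

section \<open>Blow-ups\<close>

text \<open>Each new vertex is sent by \<open>\<phi>\<close> to the vertex it copies, so the fibres
  are the cells; this allows any prescribed vertex set \<open>V\<close>. On a pair,
  \<open>inj_on \<phi> e\<close> says that its ends lie in different fibres.\<close>

definition blowup :: "'b set \<Rightarrow> ('b \<Rightarrow> 'a) \<Rightarrow> 'a wgraph \<Rightarrow> 'b wgraph" where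
  "blowup V \<phi> R = \<lparr>verts = V, wt = (\<lambda>e. if inj_on \<phi> e then wt R (\<phi> ` e) else 0)\<rparr>"

lemma verts_blowup [simp]: "verts (blowup V \<phi> R) = V"
  by (simp add: blowup_def)

lemma wt_blowup: "wt (blowup V \<phi> R) {u, v} = (if u \<noteq> v \<and> \<phi> u = \<phi> v then 0 else wt R {\<phi> u, \<phi> v})"
  by (auto simp: blowup_def)

lemma weighted_graph_blowup:
  assumes "weighted_graph R" "finite V" "\<phi> ` V \<subseteq> verts R"
  shows "weighted_graph (blowup V \<phi> R)"
  unfolding weighted_graph_def
proof (intro conjI ballI)
  fix e assume "e \<in> [verts (blowup V \<phi> R)]\<^bsup>2\<^esup>"
  then obtain u v where e: "e = {u,v}" "u \<noteq> v" "u \<in> V" "v \<in> V" by (auto simp: nsets_2_eq)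
  show "wt (blowup V \<phi> R) e \<in> {0, 1/2, 1}"
  proof (cases "\<phi> u = \<phi> v")
    case False
    then have "{\<phi> u, \<phi> v} \<in> [verts R]\<^bsup>2\<^esup>" using e assms by auto
    then show ?thesis using assms e False by (simp add: wt_blowup weighted_graph_def)
  qed (use e in \<open>simp add: wt_blowup\<close>)
qed (use assms in simp)

text \<open>Two vertices of one fibre have weight 0, so \<open>\<phi>\<close> is injective on
  \<open>Y\<close> and a skeleton projects to one with the same cardinalities.\<close>

lemma skeleton_free_blowup:
  assumes "skeleton_free p R" "\<phi> ` V \<subseteq> verts R"
  shows "skeleton_free p (blowup V \<phi> R)"
  unfolding skeleton_free_def
proof
  assume "\<exists>X Y. is_skeleton p (blowup V \<phi> R) X Y"
  then obtain X Y where "is_skeleton p (blowup V \<phi> R) X Y" by blast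
  then have XY: "X \<subseteq> Y" "Y \<subseteq> V" "card X + card Y = p"
    and X1: "\<And>u v. u \<in> X \<Longrightarrow> v \<in> X \<Longrightarrow> u \<noteq> v \<Longrightarrow> wt (blowup V \<phi> R) {u,v} = 1"
    and Y1: "\<And>u v. u \<in> Y \<Longrightarrow> v \<in> Y \<Longrightarrow> u \<noteq> v \<Longrightarrow> wt (blowup V \<phi> R) {u,v} \<ge> 1/2"
    unfolding is_skeleton_def by auto
  have inj: "inj_on \<phi> Y"
  proof (rule inj_onI, rule ccontr)
    fix u v assume "u \<in> Y" "v \<in> Y" "\<phi> u = \<phi> v" "u \<noteq> v"
    with Y1[of u v] show False by (simp add: wt_blowup)
  qed
  have "is_skeleton p R (\<phi> ` X) (\<phi> ` Y)"
    unfolding is_skeleton_def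
  proof (intro conjI ballI)
    show "\<phi> ` X \<subseteq> \<phi> ` Y" "\<phi> ` Y \<subseteq> verts R" using XY assms by auto
    show "card (\<phi> ` X) + card (\<phi> ` Y) = p"
      using XY inj by (simp add: card_image inj_on_subset)
  next
    fix e assume "e \<in> [\<phi> ` X]\<^bsup>2\<^esup>"
    then obtain u v where "u \<in> X" "v \<in> X" "\<phi> u \<noteq> \<phi> v" "e = {\<phi> u, \<phi> v}" by (auto simp: nsets_2_eq)
    with X1[of u v] show "wt R e = 1" by (auto simp: wt_blowup)
  next
    fix e assume "e \<in> [\<phi> ` Y]\<^bsup>2\<^esup>"
    then obtain u v where "u \<in> Y" "v \<in> Y" "\<phi> u \<noteq> \<phi> v" "e = {\<phi> u, \<phi> v}" by (auto simp: nsets_2_eq)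
    with Y1[of u v] show "1/2 \<le> wt R e" by (auto simp: wt_blowup)
  qed
  with assms show False by (auto simp: skeleton_free_def)
qed

section \<open>Counting cliques in a blow-up\<close>

lemma card_transversals:
  assumes "finite V" "finite L"
  shows "card {K. K \<subseteq> V \<and> inj_on \<phi> K \<and> \<phi> ` K = L} = (\<Prod>i\<in>L. card {v\<in>V. \<phi> v = i})"
proof -
  let ?F = "\<Pi>\<^sub>E i\<in>L. {v\<in>V. \<phi> v = i}"
  have "bij_betw (\<lambda>f. f ` L) ?F {K. K \<subseteq> V \<and> inj_on \<phi> K \<and> \<phi> ` K = L}"
    unfolding bij_betw_def
  proof
    have \<phi>: "\<phi> (f i) = i" if "f \<in> ?F" "i \<in> L" for f i
      using that by (auto simp: PiE_iff)
    show "inj_on (\<lambda>f. f ` L) ?F"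
    proof (rule inj_onI)
      fix f g assume f: "f \<in> ?F" and g: "g \<in> ?F" and eq: "f ` L = g ` L"
      show "f = g"
      proof (rule PiE_ext[OF f g])
        fix i assume i: "i \<in> L"
        then obtain j where "j \<in> L" "f i = g j" using eq by blast
        then show "f i = g i" using \<phi>[OF f i] \<phi>[OF g \<open>j \<in> L\<close>] by simp
      qed
    qed
    show "(\<lambda>f. f ` L) ` ?F = {K. K \<subseteq> V \<and> inj_on \<phi> K \<and> \<phi> ` K = L}" (is "?A = ?B")
    proof
      show "?A \<subseteq> ?B"
      proof
        fix K assume "K \<in> ?A"
        then obtain f where f: "f \<in> ?F" "K = f ` L" by blast
        then have "f ` L \<subseteq> V" by (auto simp: PiE_iff)
        moreover have "inj_on \<phi> K" using \<phi>[OF f(1)] f(2) by (auto simp: inj_on_def)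
        moreover have "\<phi> ` K = L" using \<phi>[OF f(1)] f(2) by (auto simp: image_image)
        ultimately show "K \<in> ?B" using f by simp
      qed
      show "?B \<subseteq> ?A"
      proof
        fix K assume K: "K \<in> ?B"
        let ?f = "restrict (inv_into K \<phi>) L"
        have "?f \<in> ?F" using K by (auto intro: inv_into_into f_inv_into_f)
        moreover have "?f ` L = K" using K by (auto simp: inv_into_into image_iff)
        ultimately show "K \<in> ?A" by blast
      qed
    qed
  qed
  then show ?thesis using assms by (simp add: bij_betw_same_card[symmetric] card_PiE)
qed

text \<open>A set with two vertices in one fibre contributes 0. The other sets are grouped by their
  image \<open>L\<close>; all transversals over \<open>L\<close> have the same weight, and their
  number is the product of the sizes.\<close>

lemma clique_count_blowup:
  assumes "finite V" "finite (verts R)" "\<phi> ` V \<subseteq> verts R"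
    and x: "\<And>i. i \<in> verts R \<Longrightarrow> card {v\<in>V. \<phi> v = i} = x i"
  shows "clique_count q (blowup V \<phi> R) = vcount (wt R) (\<lambda>i. real (x i)) q (verts R)"
proof -
  let ?w = "wt (blowup V \<phi> R)" and ?S = "{K\<in>[V]\<^bsup>q\<^esup>. inj_on \<phi> K}"
  define h where "h L = (\<Prod>e\<in>[L]\<^bsup>2\<^esup>. wt R e)" for L
  have fin: "finite ([V]\<^bsup>q\<^esup>)" using assms by (simp add: finite_imp_finite_nsets)
  have "clique_count q (blowup V \<phi> R) = (\<Sum>K\<in>[V]\<^bsup>q\<^esup>. \<Prod>e\<in>[K]\<^bsup>2\<^esup>. ?w e)"
    by (simp add: clique_count_def set_weight_def)
  also have "\<dots> = (\<Sum>K\<in>?S. \<Prod>e\<in>[K]\<^bsup>2\<^esup>. ?w e)"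
  proof (rule sum.mono_neutral_right[OF fin])
    show "\<forall>K\<in>[V]\<^bsup>q\<^esup> - ?S. (\<Prod>e\<in>[K]\<^bsup>2\<^esup>. ?w e) = 0"
    proof
      fix K assume "K \<in> [V]\<^bsup>q\<^esup> - ?S"
      then obtain u v where uv: "finite K" "u \<in> K" "v \<in> K" "u \<noteq> v" "\<phi> u = \<phi> v"
        by (auto simp: nsets_def inj_on_def)
      then have "{u,v} \<in> [K]\<^bsup>2\<^esup>" "?w {u,v} = 0" by (auto simp: wt_blowup)
      then show "(\<Prod>e\<in>[K]\<^bsup>2\<^esup>. ?w e) = 0"
        using uv(1) by (intro prod_zero) (auto simp: finite_imp_finite_nsets)
    qed
  qed auto
  also have "\<dots> = (\<Sum>K\<in>?S. h (\<phi> ` K))"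
  proof (rule sum.cong)
    fix K assume "K \<in> ?S"
    then have inj: "inj_on \<phi> K" by simp
    then have bij: "bij_betw (\<lambda>e. \<phi> ` e) ([K]\<^bsup>2\<^esup>) ([\<phi> ` K]\<^bsup>2\<^esup>)"
      by (intro bij_betw_nsets) (auto simp: bij_betw_def)
    have "(\<Prod>e\<in>[K]\<^bsup>2\<^esup>. ?w e) = (\<Prod>e\<in>[K]\<^bsup>2\<^esup>. wt R (\<phi> ` e))"
    proof (rule prod.cong)
      fix e assume "e \<in> [K]\<^bsup>2\<^esup>"
      then have "inj_on \<phi> e" using inj by (auto simp: nsets_def intro: inj_on_subset)
      then show "?w e = wt R (\<phi> ` e)" by (simp add: blowup_def)
    qed simp
    then show "(\<Prod>e\<in>[K]\<^bsup>2\<^esup>. ?w e) = h (\<phi> ` K)"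
      using prod.reindex_bij_betw[OF bij, of "wt R"] by (simp add: h_def)
  qed simp
  also have "\<dots> = (\<Sum>L\<in>[verts R]\<^bsup>q\<^esup>. \<Sum>K\<in>{K\<in>?S. \<phi> ` K = L}. h (\<phi> ` K))"
  proof (rule sum.group[symmetric])
    show "(\<lambda>K. \<phi> ` K) ` ?S \<subseteq> [verts R]\<^bsup>q\<^esup>"
      using assms(3) by (auto simp: nsets_def card_image)
  qed (use assms fin in \<open>auto simp: finite_imp_finite_nsets\<close>)
  also have "\<dots> = (\<Sum>L\<in>[verts R]\<^bsup>q\<^esup>. (\<Prod>i\<in>L. real (x i)) * h L)"
  proof (rule sum.cong)
    fix L assume L: "L \<in> [verts R]\<^bsup>q\<^esup>"
    then have eq: "{K\<in>?S. \<phi> ` K = L} = {K. K \<subseteq> V \<and> inj_on \<phi> K \<and> \<phi> ` K = L}"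
      using assms by (auto simp: nsets_def card_image intro: finite_subset)
    have "card {K\<in>?S. \<phi> ` K = L} = (\<Prod>i\<in>L. card {v\<in>V. \<phi> v = i})"
      unfolding eq using L assms by (intro card_transversals) (auto simp: nsets_def)
    also have "\<dots> = (\<Prod>i\<in>L. x i)"
      using L x by (intro prod.cong) (auto simp: nsets_def)
    finally show "(\<Sum>K\<in>{K\<in>?S. \<phi> ` K = L}. h (\<phi> ` K)) = (\<Prod>i\<in>L. real (x i)) * h L"
      by simp
  qed simp
  finally show ?thesis by (simp add: vcount_def h_def)
qed

lemma obtain_fibres:
  assumes "finite V" "finite I" "(\<Sum>i\<in>I. x i) = card V"
  obtains \<phi> where "\<phi> ` V \<subseteq> I" "\<And>i. i \<in> I \<Longrightarrow> card {v\<in>V. \<phi> v = i} = x i"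
proof -
  let ?S = "SIGMA i:I. {..<x i}"
  have "card ?S = card V" using assms by simp
  then obtain h where h: "bij_betw h V ?S"
    using assms by (metis finite_SigmaI finite_lessThan finite_same_card_bij)
  have "card {v\<in>V. fst (h v) = i} = x i" if "i \<in> I" for i
  proof -
    have "bij_betw h {v\<in>V. fst (h v) = i} ({i} \<times> {..<x i})"
    proof (rule bij_betw_imageI)
      show "inj_on h {v\<in>V. fst (h v) = i}"
        using h by (auto simp: bij_betw_def intro: inj_on_subset)
      have "h ` {v\<in>V. fst (h v) = i} = {p \<in> h ` V. fst p = i}" by blast
      also have "\<dots> = {p \<in> ?S. fst p = i}" using h by (simp add: bij_betw_def)
      also have "\<dots> = {i} \<times> {..<x i}" using that by auto
      finally show "h ` {v\<in>V. fst (h v) = i} = {i} \<times> {..<x i}" .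
    qed
    then show ?thesis by (simp add: bij_betw_same_card)
  qed
  moreover have "(fst \<circ> h) ` V \<subseteq> I" using bij_betwE[OF h] by fastforce
  ultimately show ?thesis using that[of "fst \<circ> h"] by simp
qed

text \<open>A vertex-weighted graph encodes its blow-up, in which vertex \<open>i\<close> is replaced by \<open>x i\<close>
  vertices at mutual weight 0.\<close>

definition config :: "nat \<Rightarrow> nat \<Rightarrow> 'a wgraph \<Rightarrow> ('a \<Rightarrow> nat) \<Rightarrow> bool" where
  "config p n R x \<longleftrightarrow> weighted_graph R \<and> skeleton_free p R \<and> (\<Sum>i\<in>verts R. x i) = n"

abbreviation config_count :: "nat \<Rightarrow> 'a wgraph \<Rightarrow> ('a \<Rightarrow> nat) \<Rightarrow> real" where
  "config_count q R x \<equiv> vcount (wt R) (\<lambda>i. real (x i)) q (verts R)"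

lemma config_blowup:
  assumes "config p (card V) R x" "finite V"
  obtains \<phi> where "\<phi> ` V \<subseteq> verts R" "\<And>i. i \<in> verts R \<Longrightarrow> card {v\<in>V. \<phi> v = i} = x i"
    "weighted_graph (blowup V \<phi> R)" "skeleton_free p (blowup V \<phi> R)"
    "clique_count q (blowup V \<phi> R) = config_count q R x"
proof -
  have R: "weighted_graph R" "skeleton_free p R" "(\<Sum>i\<in>verts R. x i) = card V" "finite (verts R)"
    using assms by (auto simp: config_def weighted_graph_def)
  from obtain_fibres[OF assms(2) R(4,3)] obtain \<phi> where
    \<phi>: "\<phi> ` V \<subseteq> verts R" "\<And>i. i \<in> verts R \<Longrightarrow> card {v\<in>V. \<phi> v = i} = x i" by blast
  show ?thesis
    by (rule that[OF \<phi> weighted_graph_blowup[OF R(1) assms(2) \<phi>(1)]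
          skeleton_free_blowup[OF R(2) \<phi>(1)] clique_count_blowup[OF assms(2) R(4) \<phi>]])
qed

text \<open>Serves twice: as a competitor, so that a maximum exists, and as the extremal graph when
  the maximum is 0.\<close>

definition independent_graph :: "'a set \<Rightarrow> 'a wgraph" where
  "independent_graph V = \<lparr>verts = V, wt = (\<lambda>_. 0)\<rparr>"

lemma independent_graph:
  assumes "finite V" "2 < p"
  shows "weighted_graph (independent_graph V)" "skeleton_free p (independent_graph V)"
    "profile_graph (independent_graph V)" "0 \<le> clique_count q (independent_graph V)"
proof -
  show w: "weighted_graph (independent_graph V)"
    using assms by (simp add: weighted_graph_def independent_graph_def)
  show "skeleton_free p (independent_graph V)"
    unfolding skeleton_free_def
  proof
    assume "\<exists>X Y. is_skeleton p (independent_graph V) X Y"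
    then obtain X Y where XY: "X \<subseteq> Y" "Y \<subseteq> V" "card X + card Y = p" "[Y]\<^bsup>2\<^esup> = {}"
      by (force simp: is_skeleton_def independent_graph_def)
    then have "finite Y" using assms finite_subset by blast
    \<comment> \<open>Without pairs in \<open>Y\<close>, a skeleton has total size at most 2, which
      is less than \<open>p\<close>.\<close>
    then have "card Y < 2" "card X \<le> card Y" using XY by (auto simp: nsets_eq_empty_iff card_mono)
    then show False using XY assms by simp
  qed
  have "has_profile [1] (independent_graph V)"
    unfolding has_profile_def independent_graph_def
    by (intro conjI exI[of _ "\<lambda>_. V"] exI[of _ "\<lambda>_ _. V"]) (auto simp: disjoint_family_on_def)
  then show "profile_graph (independent_graph V)" using w by (auto simp: profile_graph_def)
  show "0 \<le> clique_count q (independent_graph V)"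
    unfolding clique_count_eq_vcount by (rule vcount_nonneg) (auto simp: independent_graph_def)
qed

lemma obtain_max_config_count:
  fixes V :: "'a set"
  assumes V: "finite V" "2 < p"
  obtains M and R0 :: "'a wgraph" where
    "\<And>R :: 'a wgraph. \<And>x. config p (card V) R x \<Longrightarrow> config_count q R x \<le> M"
    "config p (card V) R0 (\<lambda>_. 1)" "config_count q R0 (\<lambda>_. 1) = M" "0 \<le> M"
proof -
  define A :: "'a wgraph set" where "A = {R. verts R = V \<and> weighted_graph R \<and> skeleton_free p R}"
  let ?W = "[V]\<^bsup>2\<^esup> \<rightarrow>\<^sub>E {0, 1/2, 1 :: real}"
  \<comment> \<open>The set \<open>A\<close> itself may be infinite, as weights of sets other than
    pairs are free. The count depends only on the restriction to pairs, which leaves finitely many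
    values.\<close>
  have "clique_count q ` A \<subseteq> (\<lambda>w. vcount w (\<lambda>_. 1) q V) ` ?W"
  proof
    fix m assume "m \<in> clique_count q ` A"
    then obtain R where R: "verts R = V" "weighted_graph R" "m = clique_count q R" by (auto simp: A_def)
    then have "restrict (wt R) ([V]\<^bsup>2\<^esup>) \<in> ?W" by (auto simp: weighted_graph_def)
    moreover have "m = vcount (restrict (wt R) ([V]\<^bsup>2\<^esup>)) (\<lambda>_. 1) q V"
      unfolding R clique_count_eq_vcount using R by (intro vcount_cong) auto
    ultimately show "m \<in> (\<lambda>w. vcount w (\<lambda>_. 1) q V) ` ?W" by blast
  qed
  then have fin: "finite (clique_count q ` A)"
    using V by (auto intro!: finite_PiE finite_imp_finite_nsets elim: finite_subset)
  have ind: "independent_graph V \<in> A"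
    using independent_graph[OF V] by (simp add: A_def) (simp add: independent_graph_def)
  define M where "M = Max (clique_count q ` A)"
  obtain R0 where R0: "R0 \<in> A" "clique_count q R0 = M"
    using Max_in[OF fin] ind by (force simp: M_def)
  have le: "clique_count q R \<le> M" if "R \<in> A" for R
    using fin that by (simp add: M_def)
  show ?thesis
  proof (rule that)
    fix R :: "'a wgraph" and x assume R: "config p (card V) R x"
    \<comment> \<open>A configuration of the right total size is realised by a blow-up on
      \<open>V\<close>, which lies in \<open>A\<close>.\<close>
    obtain \<phi> where "weighted_graph (blowup V \<phi> R)" "skeleton_free p (blowup V \<phi> R)"
      "clique_count q (blowup V \<phi> R) = config_count q R x"
      using config_blowup[OF R V(1)] by metis
    then show "config_count q R x \<le> M" using le[of "blowup V \<phi> R"] by (simp add: A_def)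
  next
    show "config p (card V) R0 (\<lambda>_. 1)" using R0 by (auto simp: A_def config_def)
    show "config_count q R0 (\<lambda>_. 1) = M" using R0 by (simp add: clique_count_eq_vcount)
    show "0 \<le> M" using le[OF ind] independent_graph(4)[OF V, of q] by simp
  qed
qed

section \<open>Symmetrization\<close>

lemma nsets_2_member:
  assumes "e \<in> [A]\<^bsup>2\<^esup>" "i \<in> e"
  shows "\<exists>k\<in>A. k \<noteq> i \<and> e = {i,k}"
  using assms by (auto simp: nsets_2_eq insert_commute)

lemma skeleton_free_subset:
  assumes "skeleton_free p R" "W \<subseteq> verts R"
  shows "skeleton_free p (R\<lparr>verts := W\<rparr>)"
  using assms unfolding skeleton_free_def is_skeleton_def by auto

lemma weighted_graph_subset:
  assumes "weighted_graph R" "W \<subseteq> verts R"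
  shows "weighted_graph (R\<lparr>verts := W\<rparr>)"
  using assms nsets_mono[OF assms(2), of 2] by (auto simp: weighted_graph_def intro: finite_subset)

text \<open>Every vertex set can serve as \<open>Y\<close> here, so the largest skeleton over a
  given \<open>X\<close> takes all vertices; one of total size above \<open>p\<close> can be
  trimmed.\<close>

lemma skeleton_free_iff:
  assumes fin: "finite (verts R)" and half: "\<And>e. e \<in> [verts R]\<^bsup>2\<^esup> \<Longrightarrow> 1/2 \<le> wt R e"
  shows "skeleton_free p R \<longleftrightarrow>
    (\<forall>X \<subseteq> verts R. (\<forall>e\<in>[X]\<^bsup>2\<^esup>. wt R e = 1) \<longrightarrow> card X + card (verts R) < p)"
    (is "_ \<longleftrightarrow> ?small")
proof
  assume sf: "skeleton_free p R"
  show ?small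
  proof (intro allI impI, rule ccontr)
    fix X assume X: "X \<subseteq> verts R" "\<forall>e\<in>[X]\<^bsup>2\<^esup>. wt R e = 1" "\<not> card X + card (verts R) < p"
    \<comment> \<open>Trimming shrinks \<open>X\<close> first; \<open>Y\<close> is shrunk, with
      \<open>X'\<close> empty, only when the vertices alone already number at least
      \<open>p\<close>.\<close>
    have "\<exists>X' Y. X' \<subseteq> X \<and> X' \<subseteq> Y \<and> Y \<subseteq> verts R \<and> card X' + card Y = p"
    proof (cases "p \<le> card (verts R)")
      case True
      then obtain Y where "Y \<subseteq> verts R" "card Y = p" using obtain_subset_with_card_n by metis
      then show ?thesis by (intro exI[of _ "{}"] exI[of _ Y]) auto
    next
      case False
      then have "p - card (verts R) \<le> card X" using X by simp
      then obtain X' where "X' \<subseteq> X" "card X' = p - card (verts R)"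
        using obtain_subset_with_card_n by metis
      then show ?thesis using X False by (intro exI[of _ X'] exI[of _ "verts R"]) auto
    qed
    then obtain X' Y where XY: "X' \<subseteq> X" "X' \<subseteq> Y" "Y \<subseteq> verts R" "card X' + card Y = p" by blast
    then have "is_skeleton p R X' Y"
      using X half nsets_mono[of X' X 2] nsets_mono[of Y "verts R" 2] unfolding is_skeleton_def by blast
    with sf show False by (auto simp: skeleton_free_def)
  qed
next
  assume small: ?small
  show "skeleton_free p R"
    unfolding skeleton_free_def
  proof
    assume "\<exists>X Y. is_skeleton p R X Y"
    then obtain X Y where XY: "X \<subseteq> Y" "Y \<subseteq> verts R" "\<forall>e\<in>[X]\<^bsup>2\<^esup>. wt R e = 1" "card X + card Y = p"
      unfolding is_skeleton_def by blast
    then have "card X + card (verts R) < p" using small by (meson order_trans)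
    moreover have "card Y \<le> card (verts R)" using XY fin by (simp add: card_mono)
    ultimately show False using XY by linarith
  qed
qed

lemma remove_null_vertex:
  assumes "config p n R x" "v \<in> verts R" "x v = 0"
  shows "config p n (R\<lparr>verts := verts R - {v}\<rparr>) x"
    "config_count (Suc q) (R\<lparr>verts := verts R - {v}\<rparr>) x = config_count (Suc q) R x"
proof -
  have fin: "finite (verts R)" using assms by (simp add: config_def weighted_graph_def)
  then have "(\<Sum>i\<in>verts R. x i) = (\<Sum>i\<in>verts R - {v}. x i)" using assms by (simp add: sum.remove)
  then show "config p n (R\<lparr>verts := verts R - {v}\<rparr>) x"
    using assms by (auto simp: config_def intro!: skeleton_free_subset weighted_graph_subset)
  show "config_count (Suc q) (R\<lparr>verts := verts R - {v}\<rparr>) x = config_count (Suc q) R x"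
    using vcount_insert[of "verts R - {v}" v "wt R" "\<lambda>i. real (x i)" q] fin assms
    by (simp add: insert_absorb)
qed

text \<open>No clique of positive weight uses both \<open>u\<close> and \<open>v\<close>, so the count is affine in
  \<open>(x u, x v)\<close>, and one of the two vertices can absorb the other.\<close>

lemma merge_nonadjacent:
  fixes R :: "'a wgraph"
  assumes cfg: "config p n R x" and uv: "u \<in> verts R" "v \<in> verts R" "u \<noteq> v" "wt R {u,v} = 0"
  shows "\<exists>(R' :: 'a wgraph) x'. config p n R' x' \<and> card (verts R') < card (verts R) \<and>
    config_count (Suc (Suc q)) R x \<le> config_count (Suc (Suc q)) R' x'"
proof -
  let ?J = "verts R - {u,v}"
  define f where "f i = vcount (wt R) (\<lambda>k. real (x k) * wt R {i,k}) (Suc q) ?J" for i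
  define c where "c = vcount (wt R) (\<lambda>k. real (x k)) (Suc (Suc q)) ?J"
  have fin: "finite (verts R)" using cfg by (simp add: config_def weighted_graph_def)
  have V: "insert u (insert v ?J) = verts R" using uv by auto
  have sum: "(\<Sum>i\<in>?J. x i) + x u + x v = n"
  proof -
    have "(\<Sum>i\<in>insert u (insert v ?J). x i) = n" unfolding V using cfg by (simp add: config_def)
    then show ?thesis using fin uv by simp
  qed
  have count: "config_count (Suc (Suc q)) R x = c + x u * f u + x v * f v"
    using vcount_insert2[of ?J u v "wt R" "\<lambda>k. real (x k)" q] fin uv unfolding V c_def f_def by simp
  \<comment> \<open>The vertex \<open>a\<close> with the larger linear coefficient absorbs
    \<open>b\<close>.\<close>
  have main: ?thesis if ab: "{a,b} = {u,v}" "a \<noteq> b" "f b \<le> f a" for a b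
  proof (intro exI conjI)
    let ?R = "R\<lparr>verts := verts R - {b}\<rparr>" and ?x = "x(a := x a + x b)"
    have ab': "a \<in> verts R" "b \<in> verts R" "verts R - {b} = insert a ?J" "a \<notin> ?J" "b \<notin> ?J"
      using ab uv by auto
    have "(\<Sum>i\<in>?J. ?x i) = (\<Sum>i\<in>?J. x i)" using ab' by (intro sum.cong) auto
    moreover have "x a + x b = x u + x v" using ab by (auto simp: doubleton_eq_iff)
    moreover have "(\<Sum>i\<in>insert a ?J. ?x i) = ?x a + (\<Sum>i\<in>?J. ?x i)" using fin ab' by simp
    ultimately have "(\<Sum>i\<in>verts ?R. ?x i) = n" unfolding ab'(3)[symmetric] using sum by simp
    then show "config p n ?R ?x"
      using cfg by (auto simp: config_def intro!: skeleton_free_subset weighted_graph_subset)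
    show "card (verts ?R) < card (verts R)" using card_Diff1_less[OF fin ab'(2)] by simp
    have "config_count (Suc (Suc q)) ?R ?x
      = vcount (wt R) (\<lambda>k. real (?x k)) (Suc (Suc q)) ?J
        + ?x a * vcount (wt R) (\<lambda>k. real (?x k) * wt R {a,k}) (Suc q) ?J"
      using vcount_insert[of ?J a "wt R" "\<lambda>k. real (?x k)" "Suc q"] fin ab' by simp
    also have "vcount (wt R) (\<lambda>k. real (?x k)) (Suc (Suc q)) ?J = c"
      unfolding c_def using ab' by (intro vcount_cong) auto
    also have "vcount (wt R) (\<lambda>k. real (?x k) * wt R {a,k}) (Suc q) ?J = f a"
      unfolding f_def using ab' by (intro vcount_cong) auto
    finally have "config_count (Suc (Suc q)) ?R ?x = c + real (x a) * f a + real (x b) * f a"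
      by (simp add: algebra_simps)
    moreover have "real (x b) * f b \<le> real (x b) * f a" using ab by (simp add: mult_left_mono)
    moreover have "config_count (Suc (Suc q)) R x = c + real (x a) * f a + real (x b) * f b"
      using count ab by (auto simp: doubleton_eq_iff)
    ultimately show "config_count (Suc (Suc q)) R x \<le> config_count (Suc (Suc q)) ?R ?x" by linarith
  qed
  show ?thesis using main[of u v] main[of v u] uv by (cases "f u \<le> f v") auto
qed

text \<open>The pair \<open>{i,j}\<close> keeps its weight, so that \<open>i\<close> and
  \<open>j\<close> remain two cells instead of merging into one.\<close>

definition clone :: "'a \<Rightarrow> 'a \<Rightarrow> 'a wgraph \<Rightarrow> 'a wgraph" where
  "clone i j R = R\<lparr>wt := (\<lambda>e. if j \<in> e \<and> i \<notin> e then wt R (insert i (e - {j})) else wt R e)\<rparr>"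

lemma verts_clone [simp]: "verts (clone i j R) = verts R"
  by (simp add: clone_def)

lemma wt_clone:
  "i \<noteq> j \<Longrightarrow> k \<noteq> i \<Longrightarrow> k \<noteq> j \<Longrightarrow> wt (clone i j R) {j,k} = wt R {i,k}"
  "j \<notin> e \<Longrightarrow> wt (clone i j R) e = wt R e"
  "wt (clone i j R) {i,k} = wt R {i,k}"
  by (auto simp: clone_def insert_Diff_if)

text \<open>The coefficients use only the sizes off \<open>i\<close> and \<open>j\<close>, so they
  are common to all redistributions \<open>a\<close>, \<open>b\<close>; this is the quadratic
  treated in \<open>symmetrization\<close>.\<close>

lemma half_config_count:
  assumes "finite (verts R)" "i \<in> verts R" "j \<in> verts R" "i \<noteq> j" "wt R {i,j} = 1/2"
  shows "config_count (Suc (Suc q)) R (x(i := a, j := b))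
    = vcount (wt R) (\<lambda>k. real (x k)) (Suc (Suc q)) (verts R - {i,j})
      + a * vcount (wt R) (\<lambda>k. real (x k) * wt R {i,k}) (Suc q) (verts R - {i,j})
      + b * vcount (wt R) (\<lambda>k. real (x k) * wt R {j,k}) (Suc q) (verts R - {i,j})
      + real a * real b * vcount (wt R) (\<lambda>k. real (x k) * wt R {i,k} * wt R {j,k}) q (verts R - {i,j}) / 2"
proof -
  let ?J = "verts R - {i,j}"
  define y where "y = x(i := a, j := b)"
  have y: "y i = a" "y j = b" using assms by (auto simp: y_def)
  have V: "insert i (insert j ?J) = verts R" using assms by auto
  have yk: "y k = x k" if "k \<in> ?J" for k using that by (simp add: y_def)
  have c1: "vcount (wt R) (\<lambda>k. real (y k)) m ?J = vcount (wt R) (\<lambda>k. real (x k)) m ?J" for m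
    by (rule vcount_cong) (simp_all add: yk)
  have c2: "vcount (wt R) (\<lambda>k. real (y k) * h k) m ?J = vcount (wt R) (\<lambda>k. real (x k) * h k) m ?J"
    for h m by (rule vcount_cong) (simp_all add: yk)
  have c3: "vcount (wt R) (\<lambda>k. real (y k) * h k * h' k) m ?J
    = vcount (wt R) (\<lambda>k. real (x k) * h k * h' k) m ?J" for h h' m
    by (rule vcount_cong) (simp_all add: yk)
  have "config_count (Suc (Suc q)) R y = vcount (wt R) (\<lambda>k. real (y k)) (Suc (Suc q)) ?J
      + y i * vcount (wt R) (\<lambda>k. real (y k) * wt R {i,k}) (Suc q) ?J
      + y j * vcount (wt R) (\<lambda>k. real (y k) * wt R {j,k}) (Suc q) ?J
      + real (y i) * real (y j) * wt R {i,j} * vcount (wt R) (\<lambda>k. real (y k) * wt R {i,k} * wt R {j,k}) q ?J"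
    using vcount_insert2[of ?J i j "wt R" "\<lambda>k. real (y k)" q] assms unfolding V by simp
  then show ?thesis unfolding c1 c2 c3 y assms(5) by (simp add: y_def)
qed

lemma clone_config_count:
  assumes "finite (verts R)" "i \<in> verts R" "j \<in> verts R" "i \<noteq> j" "wt R {i,j} = 1/2"
  shows "config_count (Suc (Suc q)) (clone i j R) (x(i := a, j := b))
    = vcount (wt R) (\<lambda>k. real (x k)) (Suc (Suc q)) (verts R - {i,j})
      + real (a + b) * vcount (wt R) (\<lambda>k. real (x k) * wt R {i,k}) (Suc q) (verts R - {i,j})
      + real a * real b * vcount (wt R) (\<lambda>k. real (x k) * wt R {i,k} * wt R {i,k}) q (verts R - {i,j}) / 2"
proof -
  let ?J = "verts R - {i,j}" and ?w = "wt (clone i j R)"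
  have e: "vcount ?w (\<lambda>k. real (x k)) m ?J = vcount (wt R) (\<lambda>k. real (x k)) m ?J"
    "vcount ?w (\<lambda>k. real (x k) * ?w {i,k}) m ?J = vcount (wt R) (\<lambda>k. real (x k) * wt R {i,k}) m ?J"
    "vcount ?w (\<lambda>k. real (x k) * ?w {j,k}) m ?J = vcount (wt R) (\<lambda>k. real (x k) * wt R {i,k}) m ?J"
    "vcount ?w (\<lambda>k. real (x k) * ?w {i,k} * ?w {j,k}) m ?J
      = vcount (wt R) (\<lambda>k. real (x k) * wt R {i,k} * wt R {i,k}) m ?J" for m
    using assms(4) by (auto intro!: vcount_cong wt_clone simp: wt_clone nsets_def)
  show ?thesis
    using half_config_count[where R="clone i j R" and i=i and j=j and q=q and x=x and a=a and b=b] assms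
    unfolding verts_clone e by (simp add: wt_clone algebra_simps)
qed

text \<open>By \<open>skeleton_free_iff\<close> only the sizes of weight-1 cliques matter. Such a
  clique of the clone that contains \<open>j\<close> avoids \<open>i\<close>, since that pair has
  weight 1/2; exchanging \<open>j\<close> for \<open>i\<close> gives a weight-1 clique of
  \<open>R\<close> of equal size.\<close>

lemma clone_config:
  assumes cfg: "config p n R x" and half: "\<And>e. e \<in> [verts R]\<^bsup>2\<^esup> \<Longrightarrow> wt R e \<in> {1/2, 1}"
    and ij: "i \<in> verts R" "j \<in> verts R" "i \<noteq> j" "wt R {i,j} = 1/2"
  shows "config p n (clone i j R) x" "\<And>e. e \<in> [verts R]\<^bsup>2\<^esup> \<Longrightarrow> wt (clone i j R) e \<in> {1/2, 1}"
proof -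
  let ?R = "clone i j R"
  have fin: "finite (verts R)" using cfg by (simp add: config_def weighted_graph_def)
  show half': "wt ?R e \<in> {1/2, 1}" if "e \<in> [verts R]\<^bsup>2\<^esup>" for e
  proof (cases "j \<in> e \<and> i \<notin> e")
    case True
    then obtain k where k: "e = {j,k}" "k \<noteq> j" "k \<noteq> i" "k \<in> verts R"
      using nsets_2_member[OF \<open>e \<in> [verts R]\<^bsup>2\<^esup>\<close>, of j] by auto
    then have "wt ?R e = wt R {i,k}" using ij by (simp add: wt_clone)
    moreover have "{i,k} \<in> [verts R]\<^bsup>2\<^esup>" using k ij by auto
    ultimately show ?thesis using half by metis
  next
    case False
    then have "wt ?R e = wt R e" by (auto simp: clone_def)
    then show ?thesis using half[OF that] by simp
  qed
  have wg: "weighted_graph ?R" using half' fin by (auto simp: weighted_graph_def)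
  have sm: "card X + card (verts R) < p" if "X \<subseteq> verts R" "\<forall>e\<in>[X]\<^bsup>2\<^esup>. wt R e = 1" for X
  proof -
    have "skeleton_free p R" using cfg by (simp add: config_def)
    then show ?thesis using skeleton_free_iff[OF fin, of p] half that by fastforce
  qed
  have "skeleton_free p ?R"
  proof (subst skeleton_free_iff)
    show "finite (verts ?R)" using fin by simp
    show "1/2 \<le> wt ?R e" if "e \<in> [verts ?R]\<^bsup>2\<^esup>" for e using half'[of e] that by auto
    show "\<forall>X\<subseteq>verts ?R. (\<forall>e\<in>[X]\<^bsup>2\<^esup>. wt ?R e = 1) \<longrightarrow> card X + card (verts ?R) < p"
    proof (intro allI impI)
      fix X assume X: "X \<subseteq> verts ?R" and X1: "\<forall>e\<in>[X]\<^bsup>2\<^esup>. wt ?R e = 1"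
      show "card X + card (verts ?R) < p"
      proof (cases "j \<in> X")
        case False
        have "wt R e = 1" if "e \<in> [X]\<^bsup>2\<^esup>" for e
        proof -
          have "j \<notin> e" using False that by (auto simp: nsets_def)
          then show ?thesis using X1 that wt_clone(2)[of j e i R] by metis
        qed
        then show ?thesis using sm X by simp
      next
        case True
        have "i \<notin> X"
        proof
          assume "i \<in> X"
          then have "{i,j} \<in> [X]\<^bsup>2\<^esup>" using True ij by simp
          then show False using X1 ij wt_clone(3)[of i j R j] by force
        qed
        let ?X = "insert i (X - {j})"
        have "wt R e = 1" if "e \<in> [?X]\<^bsup>2\<^esup>" for e
        proof (cases "i \<in> e")
          case True
          then obtain k where k: "e = {i,k}" "k \<in> X" "k \<noteq> i" "k \<noteq> j"
            using nsets_2_member[OF \<open>e \<in> [?X]\<^bsup>2\<^esup>\<close>, of i] by auto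
          then have "{j,k} \<in> [X]\<^bsup>2\<^esup>" using \<open>j \<in> X\<close> by simp
          then show ?thesis using X1 k ij wt_clone(1)[of i j k R] by metis
        next
          case False
          then have "e \<in> [X]\<^bsup>2\<^esup>" "j \<notin> e" using that ij by (auto simp: nsets_def)
          then show ?thesis using X1 wt_clone(2)[of j e i R] by metis
        qed
        moreover have "?X \<subseteq> verts R" using X ij by auto
        moreover have "card ?X = card X"
          using True \<open>i \<notin> X\<close> finite_subset[OF X] fin
          by (metis Diff_iff card_Suc_Diff1 card_insert_disjoint finite_Diff verts_clone)
        ultimately show ?thesis using sm[of ?X] by simp
      qed
    qed
  qed
  then show "config p n ?R x" using cfg wg by (simp add: config_def)
qed

section \<open>Twin classes of weight-1 neighbourhoods\<close>

definition nbhd :: "'a wgraph \<Rightarrow> 'a \<Rightarrow> 'a set" where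
  "nbhd R i = {k \<in> verts R. k \<noteq> i \<and> wt R {i,k} = 1}"

text \<open>A potential function: these ordered pairs, diagonal included, number the sum of the
  squares of the twin class sizes.\<close>

definition twin_pairs :: "'a wgraph \<Rightarrow> ('a \<times> 'a) set" where
  "twin_pairs R = {(a,b) \<in> verts R \<times> verts R. nbhd R a = nbhd R b}"

lemma nbhd_clone:
  assumes ij: "i \<in> verts R" "j \<in> verts R" "i \<noteq> j" "wt R {i,j} \<noteq> 1" and k: "k \<in> verts R"
  shows "nbhd (clone i j R) k = (if k = j then nbhd R i
    else if i \<in> nbhd R k then insert j (nbhd R k) else nbhd R k - {j})"
proof (cases "k = j")
  case True
  have "wt (clone i j R) {j,l} = 1 \<longleftrightarrow> wt R {i,l} = 1 \<and> l \<noteq> i" if "l \<noteq> j" for l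
    using that ij by (cases "l = i") (auto simp: wt_clone insert_commute)
  then have "l \<in> nbhd (clone i j R) j \<longleftrightarrow> l \<in> nbhd R i" for l
    using ij by (cases "l = j") (auto simp: nbhd_def)
  then show ?thesis using True by auto
next
  case False
  have "l \<in> nbhd (clone i j R) k \<longleftrightarrow> l \<in> nbhd R k" if "l \<noteq> j" for l
    using that False by (simp add: nbhd_def wt_clone)
  moreover have "j \<in> nbhd (clone i j R) k \<longleftrightarrow> i \<in> nbhd R k"
    using ij False by (cases "k = i") (auto simp: nbhd_def wt_clone insert_commute)
  ultimately have *: "l \<in> nbhd (clone i j R) k \<longleftrightarrow> (if l = j then i \<in> nbhd R k else l \<in> nbhd R k)" for l
    by simp
  show ?thesis
  proof (rule set_eqI)
    fix l
    show "l \<in> nbhd (clone i j R) k \<longleftrightarrow> l \<in> (if k = j then nbhd R i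
      else if i \<in> nbhd R k then insert j (nbhd R k) else nbhd R k - {j})"
      using *[of l] False by simp
  qed
qed

text \<open>Cloning moves \<open>j\<close> from the class \<open>Tj\<close> to the class
  \<open>Ti\<close>, which is at least as large. Other twins stay twins, because their common
  neighbourhood changes by the same rule.\<close>

lemma card_twin_pairs_clone:
  assumes fin: "finite (verts R)" and ij: "i \<in> verts R" "j \<in> verts R" "i \<noteq> j" "wt R {i,j} \<noteq> 1"
    and ne: "nbhd R i \<noteq> nbhd R j"
    and le: "card {a \<in> verts R. nbhd R a = nbhd R j} \<le> card {a \<in> verts R. nbhd R a = nbhd R i}"
  shows "card (twin_pairs R) < card (twin_pairs (clone i j R))"
proof -
  let ?R = "clone i j R"
  define Ti Tj where "Ti = {a \<in> verts R. nbhd R a = nbhd R i}" and "Tj = {a \<in> verts R. nbhd R a = nbhd R j}"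
  define C where "C = {(a,b) \<in> twin_pairs R. a \<noteq> j \<and> b \<noteq> j}"
  have fin': "finite (twin_pairs R)" "finite (twin_pairs ?R)" "finite C" "finite Ti" "finite Tj"
    using fin by (auto simp: twin_pairs_def C_def Ti_def Tj_def intro: finite_subset[of _ "verts R \<times> verts R"])
  have T: "j \<in> Tj" "j \<notin> Ti" using ij ne by (auto simp: Ti_def Tj_def)
  \<comment> \<open>The pair \<open>(j,j)\<close> is counted once, so the pairs through
    \<open>j\<close> number one less than twice the size of \<open>Tj\<close>. This makes the
    inequality strict.\<close>
  have "twin_pairs R = C \<union> (Tj - {j}) \<times> {j} \<union> {j} \<times> Tj"
    using ij by (auto simp: twin_pairs_def C_def Tj_def)
  also have "card \<dots> \<le> card C + card ((Tj - {j}) \<times> {j}) + card ({j} \<times> Tj)"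
    by (intro order_trans[OF card_Un_le] add_right_mono card_Un_le)
  also have "\<dots> < card C + card Tj + card Tj"
  proof -
    have "card (Tj - {j}) < card Tj" using fin' T by (intro card_Diff1_less)
    then show ?thesis by (simp add: card_cartesian_product)
  qed
  also have "\<dots> \<le> card C + card (Ti \<times> {j}) + card ({j} \<times> Ti)"
    using le by (simp add: Ti_def Tj_def card_cartesian_product)
  also have "\<dots> = card (C \<union> Ti \<times> {j} \<union> {j} \<times> Ti)"
    using fin' T by (subst card_Un_disjoint; (subst card_Un_disjoint)?) (auto simp: C_def)
  also have "\<dots> \<le> card (twin_pairs ?R)"
  proof (rule card_mono[OF fin'(2)])
    have i: "i \<notin> nbhd R i" "j \<notin> nbhd R i" using ij by (auto simp: nbhd_def)
    have "nbhd ?R j = nbhd R i" using nbhd_clone[OF ij ij(2)] by simp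
    moreover have "nbhd ?R a = nbhd R i" if "a \<in> Ti" for a
    proof -
      have "a \<in> verts R" "a \<noteq> j" "nbhd R a = nbhd R i" using that T by (auto simp: Ti_def)
      then show ?thesis using nbhd_clone[OF ij, of a] i by simp
    qed
    moreover have "nbhd ?R a = nbhd ?R b" if "(a,b) \<in> C" for a b
    proof -
      have "a \<in> verts R" "b \<in> verts R" "a \<noteq> j" "b \<noteq> j" "nbhd R a = nbhd R b"
        using that by (auto simp: C_def twin_pairs_def)
      then show ?thesis using nbhd_clone[OF ij, of a] nbhd_clone[OF ij, of b] by simp
    qed
    moreover have "Ti \<subseteq> verts R" "C \<subseteq> verts R \<times> verts R" by (auto simp: Ti_def C_def twin_pairs_def)
    ultimately show "C \<union> Ti \<times> {j} \<union> {j} \<times> Ti \<subseteq> twin_pairs ?R"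
      using ij by (auto simp: twin_pairs_def)
  qed
  finally show ?thesis .
qed

text \<open>Cliques have \<open>q + 2\<close> vertices, since two are split off in every expansion;
  \<open>dummy\<close> fixes the vertex type. That the bound is attained is demanded only by
  \<open>optimal\<close>.\<close>

locale optimum =
  fixes p n q :: nat and M :: real and dummy :: "'a itself"
  assumes M_pos: "0 < M"
    and bound: "\<And>(R :: 'a wgraph) x. config p n R x \<Longrightarrow> config_count (Suc (Suc q)) R x \<le> M"
begin

definition optimal :: "'a wgraph \<Rightarrow> ('a \<Rightarrow> nat) \<Rightarrow> bool" where
  "optimal R x \<longleftrightarrow> config p n R x \<and> config_count (Suc (Suc q)) R x = M \<and>
    (\<forall>e\<in>[verts R]\<^bsup>2\<^esup>. wt R e \<in> {1/2, 1}) \<and> (\<forall>i\<in>verts R. 0 < x i)"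

text \<open>Takes an optimum with the fewest vertices: otherwise a pair of weight 0 could be merged,
  or a vertex of size 0 deleted, without lowering the count.\<close>

lemma exists_optimal:
  fixes R0 :: "'a wgraph"
  assumes "config p n R0 x0" "config_count (Suc (Suc q)) R0 x0 = M"
  shows "\<exists>R x. optimal R x"
proof -
  define Q where "Q m \<longleftrightarrow> (\<exists>(R :: 'a wgraph) x. config p n R x \<and> config_count (Suc (Suc q)) R x = M
    \<and> card (verts R) = m)" for m
  have "Q (card (verts R0))" using assms by (auto simp: Q_def)
  then have "Q (LEAST m. Q m)" by (rule LeastI)
  then obtain R :: "'a wgraph" and x where R: "config p n R x" "config_count (Suc (Suc q)) R x = M"
    "card (verts R) = (LEAST m. Q m)" unfolding Q_def by blast
  have min: "\<not> card (verts R') < card (verts R)"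
    if "config p n R' x'" "config_count (Suc (Suc q)) R' x' = M" for R' :: "'a wgraph" and x'
  proof -
    have "Q (card (verts R'))" unfolding Q_def using that by blast
    then show ?thesis using Least_le[of Q "card (verts R')"] R(3) by simp
  qed
  have wg: "weighted_graph R" and fin: "finite (verts R)"
    using R by (auto simp: config_def weighted_graph_def)
  have "wt R e \<in> {1/2, 1}" if e: "e \<in> [verts R]\<^bsup>2\<^esup>" for e
  proof -
    have "wt R e \<noteq> 0"
    proof
      assume 0: "wt R e = 0"
      obtain u v where uv: "e = {u,v}" "u \<in> verts R" "v \<in> verts R" "u \<noteq> v"
        using e by (auto simp: nsets_2_eq)
      then obtain R' :: "'a wgraph" and x' where R': "config p n R' x'" "card (verts R') < card (verts R)"
        "M \<le> config_count (Suc (Suc q)) R' x'"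
        using merge_nonadjacent[OF R(1), of u v q] 0 R(2) by auto
      then show False using min[of R' x'] bound[of R' x'] by auto
    qed
    then show ?thesis using wg e by (auto simp: weighted_graph_def)
  qed
  moreover have "0 < x v" if "v \<in> verts R" for v
  proof (rule ccontr)
    assume "\<not> 0 < x v"
    then show False
      using remove_null_vertex[OF R(1) that] min R(2) fin that card_Diff1_less by fastforce
  qed
  ultimately show ?thesis using R by (auto simp: optimal_def)
qed

context
  fixes R :: "'a wgraph" and x i j
  assumes opt: "optimal R x" and ij: "i \<in> verts R" "j \<in> verts R" "i \<noteq> j" "wt R {i,j} = 1/2"
begin

private abbreviation "J \<equiv> verts R - {i,j}"
private abbreviation "g a b \<equiv> vcount (wt R) (\<lambda>k. real (x k) * wt R {a,k} * wt R {b,k}) q J"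

lemma finite_verts: "finite (verts R)"
  using opt by (simp add: optimal_def config_def weighted_graph_def)

lemma half: "e \<in> [verts R]\<^bsup>2\<^esup> \<Longrightarrow> wt R e \<in> {1/2, 1}"
  using opt by (simp add: optimal_def)

lemma half_J: "e \<in> [J]\<^bsup>2\<^esup> \<Longrightarrow> wt R e \<in> {1/2, 1}"
  by (rule half) (auto simp: nsets_def)

lemma half_ij: "a \<in> {i,j} \<Longrightarrow> k \<in> J \<Longrightarrow> wt R {a,k} \<in> {1/2, 1}"
  by (rule half) (use ij in auto)

text \<open>Positive \<open>M\<close> forces at least \<open>q + 2\<close> vertices, so
  \<open>J\<close> still contains a \<open>q\<close>-set, and all factors are positive.\<close>

lemma g_pos: "0 < g i j"
proof (rule vcount_pos)
  show "finite J" using finite_verts by simp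
  have "Suc (Suc q) \<le> card (verts R)"
  proof (rule ccontr)
    assume "\<not> ?thesis"
    then have "config_count (Suc (Suc q)) R x = 0"
      using finite_verts by (simp add: vcount_def nsets_eq_empty)
    then show False using opt M_pos by (simp add: optimal_def)
  qed
  then show "q \<le> card J" using ij finite_verts by (simp add: card_Diff_subset)
  show "0 < real (x k) * wt R {i,k} * wt R {j,k}" if "k \<in> J" for k
  proof -
    have "0 < wt R {i,k}" "0 < wt R {j,k}" using half_ij[of i k] half_ij[of j k] that by auto
    moreover have "0 < x k" using opt that by (simp add: optimal_def)
    ultimately show ?thesis by simp
  qed
  show "0 < wt R e" if "e \<in> [J]\<^bsup>2\<^esup>" for e using half_J[OF that] by auto
qed

lemma resize_config:
  assumes "a + b = x i + x j"
  shows "config p n R (x(i := a, j := b))"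
proof -
  have V: "insert i (insert j J) = verts R" using ij by auto
  have "(\<Sum>k\<in>insert i (insert j J). (x(i := a, j := b)) k) = (\<Sum>k\<in>insert i (insert j J). x k)"
    using assms ij finite_verts by simp
  then show ?thesis using opt unfolding V by (simp add: optimal_def config_def)
qed

text \<open>Resizing the two cells, and cloning in either direction after resizing, give the three
  families of bounds in \<open>symmetrization\<close>. Both directions enter although one is
  asserted, since their gains are played off against each other.\<close>

lemma clone_optimal: "optimal (clone i j R) x"
proof -
  define c where "c = vcount (wt R) (\<lambda>k. real (x k)) (Suc (Suc q)) J"
  define f where "f a = vcount (wt R) (\<lambda>k. real (x k) * wt R {a,k}) (Suc q) J" for a
  note exp = half_config_count[OF finite_verts ij, where q=q and x=x, folded c_def f_def]
  note cexp = clone_config_count[OF finite_verts ij, where q=q and x=x, folded c_def f_def]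
  have ji: "j \<in> verts R" "i \<in> verts R" "j \<noteq> i" "wt R {j,i} = 1/2" "{j,i} = {i,j}"
    using ij by (auto simp: insert_commute)
  note cexp' = clone_config_count[OF finite_verts ji(1-4), where q=q and x=x, unfolded ji(5), folded c_def f_def]
  have pos: "0 < x i" "0 < x j" "x(i := x i, j := x j) = x" using opt ij by (auto simp: optimal_def)
  have nonneg: "\<And>k. k \<in> J \<Longrightarrow> 0 \<le> real (x k)" "\<And>e. e \<in> [J]\<^bsup>2\<^esup> \<Longrightarrow> 0 \<le> wt R e"
    using half_J by fastforce+
  have gnn: "0 \<le> g a a" for a
  proof (rule vcount_nonneg)
    show "0 \<le> real (x k) * wt R {a,k} * wt R {a,k}" for k by (simp add: mult.assoc)
  qed (use nonneg in auto)
  have "c + real (x i + x j) * f i + real (x i) * real (x j) * g i i / 2 = M"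
  proof (rule symmetrization)
    show "0 < x i" "0 < x j" "0 < g i j" "0 \<le> g i i" "0 \<le> g j j" using pos g_pos gnn by auto
    show "(g i j)\<^sup>2 \<le> g i i * g j j" by (rule vcount_Cauchy_Schwarz) (use nonneg in auto)
    show "(real (x i) + real (x j)) * g i j \<le> real (x i) * g i i + real (x j) * g j j"
      if "x i \<le> 2 * x j" "x j \<le> 2 * x i"
      by (rule vcount_half_power_form) (use nonneg that half_ij in auto)
    show "M = c + real (x i) * f i + real (x j) * f j + real (x i * x j) * g i j / 2"
      using exp[of "x i" "x j"] opt unfolding pos(3) by (simp add: optimal_def)
    fix a b assume ab: "a + b = x i + x j"
    note cfg = resize_config[OF ab]
    show "c + real a * f i + real b * f j + real a * real b * g i j / 2 \<le> M"
      using bound[OF cfg] unfolding exp .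
    show "c + real (a + b) * f i + real a * real b * g i i / 2 \<le> M"
      using bound[OF clone_config(1)[OF cfg half ij]] unfolding cexp .
    have "x(i := a, j := b) = x(j := b, i := a)" using ij by auto
    then show "c + real (a + b) * f j + real a * real b * g j j / 2 \<le> M"
      using bound[OF clone_config(1)[OF cfg half ji(1-4)]] cexp'[of b a]
      by (simp add: add.commute mult.commute)
  qed
  then have "config_count (Suc (Suc q)) (clone i j R) x = M"
    using cexp[of "x i" "x j"] unfolding pos(3) by simp
  then show ?thesis
    using opt clone_config[of p n R x, OF _ half ij] by (simp add: optimal_def)
qed

text \<open>For twins the linear coefficients agree, so the split matters only through the product
  of the two sizes, with positive coefficient. Moving a vertex out of a cell larger by at least 2
  would raise that product.\<close>

lemma twins_balanced:
  assumes "nbhd R i = nbhd R j"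
  shows "x i \<le> x j + 1"
proof (rule ccontr)
  assume "\<not> ?thesis"
  then have lt: "x j + 1 < x i" by simp
  define c where "c = vcount (wt R) (\<lambda>k. real (x k)) (Suc (Suc q)) J"
  define f where "f a = vcount (wt R) (\<lambda>k. real (x k) * wt R {a,k}) (Suc q) J" for a
  note exp = half_config_count[OF finite_verts ij, where q=q and x=x, folded c_def f_def]
  have "wt R {i,k} = wt R {j,k}" if "k \<in> J" for k
  proof -
    have "wt R {i,k} = 1 \<longleftrightarrow> wt R {j,k} = 1"
      using assms that by (auto simp: nbhd_def set_eq_iff)
    then show ?thesis using half_ij[of i k] half_ij[of j k] that by auto
  qed
  then have ff: "f i = f j" unfolding f_def by (intro vcount_cong) auto
  have "config_count (Suc (Suc q)) R (x(i := x i, j := x j)) = M" using opt by (simp add: optimal_def)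
  moreover have "config_count (Suc (Suc q)) R (x(i := x i - 1, j := x j + 1)) \<le> M"
    using lt by (intro bound resize_config) simp
  ultimately have "real (x i - 1) * f j + real (x j + 1) * f j + real (x i - 1) * real (x j + 1) * g i j / 2
      \<le> real (x i) * f j + real (x j) * f j + real (x i) * real (x j) * g i j / 2"
    unfolding exp ff by linarith
  moreover have r: "real (x i - 1) = real (x i) - 1" using lt by simp
  moreover have "real (x i - 1) * f j + real (x j + 1) * f j = real (x i) * f j + real (x j) * f j"
    unfolding r by (simp add: algebra_simps)
  ultimately have "real (x i - 1) * real (x j + 1) * g i j \<le> real (x i) * real (x j) * g i j"
    by linarith
  then have "real (x i - 1) * real (x j + 1) \<le> real (x i) * real (x j)"
    using g_pos by (simp only: mult_le_cancel_right_pos)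
  then show False unfolding r using lt by (simp add: algebra_simps)
qed

end

text \<open>Among optima with the same vertices and sizes, one with the most twin pairs is taken. If
  two cells at weight 1/2 were not twins, cloning the one in the larger twin class would give
  more.\<close>

lemma exists_multipartite_optimal:
  fixes R0 :: "'a wgraph"
  assumes "config p n R0 x0" "config_count (Suc (Suc q)) R0 x0 = M"
  obtains R x where "optimal R x"
    "\<And>i j. i \<in> verts R \<Longrightarrow> j \<in> verts R \<Longrightarrow> i \<noteq> j \<Longrightarrow> wt R {i,j} = 1/2 \<Longrightarrow> nbhd R i = nbhd R j"
proof -
  obtain R1 x where R1: "optimal R1 x" using exists_optimal[OF assms] by blast
  define A where "A = (\<lambda>R. optimal R x \<and> verts R = verts R1)"
  have fin: "finite (verts R1)" using R1 by (simp add: optimal_def config_def weighted_graph_def)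
  have "card (twin_pairs R) < Suc (card (verts R1 \<times> verts R1))" if "A R" for R
  proof -
    have "twin_pairs R \<subseteq> verts R1 \<times> verts R1" using that by (auto simp: A_def twin_pairs_def)
    then have "card (twin_pairs R) \<le> card (verts R1 \<times> verts R1)"
      using fin by (intro card_mono) auto
    then show ?thesis by simp
  qed
  then obtain R where R: "A R" "\<And>R'. A R' \<Longrightarrow> card (twin_pairs R') \<le> card (twin_pairs R)"
    using ex_has_greatest_nat[of A R1 "\<lambda>R. card (twin_pairs R)"] R1 by (metis A_def order_less_imp_le)
  show ?thesis
  proof (rule that)
    show "optimal R x" using R by (simp add: A_def)
    fix i j assume ij: "i \<in> verts R" "j \<in> verts R" "i \<noteq> j" "wt R {i,j} = 1/2"
    show "nbhd R i = nbhd R j"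
    proof (rule ccontr)
      assume ne: "nbhd R i \<noteq> nbhd R j"
      have ji: "wt R {j,i} = 1/2" using ij by (simp add: insert_commute)
      have *: "A (clone i j R)" "A (clone j i R)"
        using R(1) ij ji clone_optimal[of R x i j] clone_optimal[of R x j i] by (auto simp: A_def)
      have finR: "finite (verts R)" using R(1) fin by (simp add: A_def)
      consider "card {a \<in> verts R. nbhd R a = nbhd R j} \<le> card {a \<in> verts R. nbhd R a = nbhd R i}"
        | "card {a \<in> verts R. nbhd R a = nbhd R i} \<le> card {a \<in> verts R. nbhd R a = nbhd R j}"
        by linarith
      then show False
      proof cases
        case 1
        then have "card (twin_pairs R) < card (twin_pairs (clone i j R))"
          using card_twin_pairs_clone[OF finR ij(1-3)] ij ne by simp
        then show False using R(2)[OF *(1)] by simp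
      next
        case 2
        then have "card (twin_pairs R) < card (twin_pairs (clone j i R))"
          using card_twin_pairs_clone[OF finR ij(2,1)] ij ji ne by simp
        then show False using R(2)[OF *(2)] by simp
      qed
    qed
  qed
qed

end

section \<open>The profile of an optimal graph\<close>

text \<open>No vertex is its own neighbour. With all weights 1/2 or 1, twins therefore have mutual
  weight 1/2.\<close>

lemma adjacent_nbhd_neq:
  assumes "i \<in> verts R" "j \<in> verts R" "i \<noteq> j" "wt R {i,j} = 1"
  shows "nbhd R i \<noteq> nbhd R j"
proof -
  have "j \<in> nbhd R i" "j \<notin> nbhd R j" using assms by (auto simp: nbhd_def)
  then show ?thesis by blast
qed

text \<open>Parts come from the twin classes of \<open>R\<close>, cells from the fibres. Weight 1/2
  occurs only between twins, and weight 1 never does, so the weights across and inside the parts are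
  as required.\<close>

lemma profile_blowup:
  fixes R :: "'a wgraph" and \<phi> :: "'b \<Rightarrow> 'a"
  assumes fin: "finite (verts R)" and ne: "verts R \<noteq> {}" and \<phi>: "\<phi> ` V \<subseteq> verts R"
    and x: "\<And>i. i \<in> verts R \<Longrightarrow> card {v\<in>V. \<phi> v = i} = x i"
    and half: "\<And>e. e \<in> [verts R]\<^bsup>2\<^esup> \<Longrightarrow> wt R e \<in> {1/2, 1}"
    and twins: "\<And>i j. i \<in> verts R \<Longrightarrow> j \<in> verts R \<Longrightarrow> i \<noteq> j \<Longrightarrow> wt R {i,j} = 1/2 \<Longrightarrow> nbhd R i = nbhd R j"
    and bal: "\<And>i j. i \<in> verts R \<Longrightarrow> j \<in> verts R \<Longrightarrow> nbhd R i = nbhd R j \<Longrightarrow> x i \<le> x j + 1"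
  shows "\<exists>s. has_profile s (blowup V \<phi> R)"
proof -
  define cls where "cls N = {i \<in> verts R. nbhd R i = N}" for N
  define t where "t = card (nbhd R ` verts R)"
  \<comment> \<open>The map \<open>h\<close> numbers the neighbourhoods, hence the parts;
    \<open>f N\<close> below numbers the vertices with neighbourhood \<open>N\<close>, hence the
    cells of one part.\<close>
  obtain h where "bij_betw h {0..<t} (nbhd R ` verts R)"
    using ex_bij_betw_nat_finite[of "nbhd R ` verts R"] fin by (auto simp: t_def)
  then have h: "inj_on h {..<t}" "h ` {..<t} = nbhd R ` verts R"
    by (auto simp: bij_betw_def atLeast0LessThan)
  have "\<exists>f. bij_betw f {0..<card (cls N)} (cls N)" for N
    using fin by (intro ex_bij_betw_nat_finite) (simp add: cls_def)
  then obtain f where "\<And>N. bij_betw (f N) {0..<card (cls N)} (cls N)" by metis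
  then have f: "inj_on (f N) {..<card (cls N)}" "f N ` {..<card (cls N)} = cls N" for N
    by (auto simp: bij_betw_def atLeast0LessThan)
  define s where "s = map (\<lambda>a. card (cls (h a))) [0..<t]"
  have len: "length s = t" and s: "\<And>a. a < t \<Longrightarrow> s ! a = card (cls (h a))" by (auto simp: s_def)
  define P where "P a = {v \<in> V. nbhd R (\<phi> v) = h a}" for a
  define C where "C a b = {v \<in> V. \<phi> v = f (h a) b}" for a b
  have fC: "f (h a) b \<in> verts R" "nbhd R (f (h a) b) = h a" if "a < t" "b < s ! a" for a b
    using f(2)[of "h a"] that s by (auto simp: cls_def)
  have "has_profile s (blowup V \<phi> R)"
    unfolding has_profile_def len verts_blowup
  proof (intro conjI exI allI impI ballI)
    show "s \<noteq> []" using ne fin by (auto simp: s_def t_def)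
    show "0 < s ! a" if "a < t" for a
    proof -
      have "h a \<in> nbhd R ` verts R" using h(2) that by blast
      then have "cls (h a) \<noteq> {}" by (auto simp: cls_def)
      then show ?thesis using fin that by (simp add: s card_gt_0_iff cls_def)
    qed
    show "disjoint_family_on P {..<t}"
      using h(1) by (auto simp: disjoint_family_on_def P_def inj_on_def)
    show "(\<Union>a<t. P a) = V"
    proof
      show "V \<subseteq> (\<Union>a<t. P a)"
      proof
        fix v assume v: "v \<in> V"
        then have "nbhd R (\<phi> v) \<in> h ` {..<t}" using h(2) \<phi> by blast
        then show "v \<in> (\<Union>a<t. P a)" using v by (auto simp: P_def)
      qed
    qed (auto simp: P_def)
    show "disjoint_family_on (C a) {..<s ! a}" if "a < t" for a
      using f(1)[of "h a"] that by (auto simp: disjoint_family_on_def C_def s inj_on_def)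
    show "(\<Union>b<s ! a. C a b) = P a" if a: "a < t" for a
    proof
      show "(\<Union>b<s ! a. C a b) \<subseteq> P a" using fC[OF a] by (auto simp: C_def P_def)
      show "P a \<subseteq> (\<Union>b<s ! a. C a b)"
      proof
        fix v assume v: "v \<in> P a"
        then have "\<phi> v \<in> f (h a) ` {..<card (cls (h a))}" using f(2)[of "h a"] \<phi> by (auto simp: cls_def P_def)
        then show "v \<in> (\<Union>b<s ! a. C a b)" using v a by (auto simp: C_def P_def s)
      qed
    qed
    show "card (C a b) \<le> card (C a c) + 1" if "a < t" "b < s ! a" "c < s ! a" for a b c
      using bal[of "f (h a) b" "f (h a) c"] fC[OF that(1,2)] fC[OF that(1,3)] x
      by (simp add: C_def)
    show "wt (blowup V \<phi> R) {u,v} = 1" if "a < t" "b < t" "a \<noteq> b" "u \<in> P a" "v \<in> P b" for a b u v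
    proof -
      have "h a \<noteq> h b" using h(1) that by (auto simp: inj_on_def)
      then have ne: "nbhd R (\<phi> u) \<noteq> nbhd R (\<phi> v)" using that by (simp add: P_def)
      have uv: "\<phi> u \<in> verts R" "\<phi> v \<in> verts R" "\<phi> u \<noteq> \<phi> v" using that \<phi> ne by (auto simp: P_def)
      then have "wt R {\<phi> u, \<phi> v} = 1" using half[of "{\<phi> u, \<phi> v}"] twins[OF uv] ne by auto
      then show ?thesis using uv by (simp add: wt_blowup)
    qed
    show "wt (blowup V \<phi> R) {u,v} = 1/2"
      if "a < t" "b < s ! a" "c < s ! a" "b \<noteq> c" "u \<in> C a b" "v \<in> C a c" for a b c u v
    proof -
      have uv: "\<phi> u = f (h a) b" "\<phi> v = f (h a) c" using that by (auto simp: C_def)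
      have "\<phi> u \<noteq> \<phi> v" using f(1)[of "h a"] that unfolding uv by (auto simp: inj_on_def s)
      moreover have "wt R {\<phi> u, \<phi> v} = 1/2"
        using half[of "{\<phi> u, \<phi> v}"] adjacent_nbhd_neq[of "\<phi> u" R "\<phi> v"] fC[OF that(1,2)] fC[OF that(1,3)]
          \<open>\<phi> u \<noteq> \<phi> v\<close> unfolding uv by auto
      ultimately show ?thesis by (simp add: wt_blowup)
    qed
    show "wt (blowup V \<phi> R) {u,v} = 0" if "u \<in> C a b" "v \<in> C a b" "u \<noteq> v" for a b u v
      using that by (simp add: C_def wt_blowup)
  qed
  then show ?thesis by blast
qed

theorem theorem9:
  fixes p q n :: nat and V :: "'a set"
  assumes "2 \<le> q" and "q < p" and "n \<ge> 1"
    and "finite V" and "card V = n"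
  shows "\<exists>R. verts R = V \<and>
    is_arg_max (clique_count q)
      (\<lambda>R :: 'a wgraph. weighted_graph R \<and> card (verts R) = n \<and> skeleton_free p R) R \<and>
    profile_graph R"
proof -
  obtain r where q: "q = Suc (Suc r)" using assms(1) that[of "q - 2"] by simp
  have p: "2 < p" using assms by simp
  obtain M and R0 :: "'a wgraph" where
    max: "\<And>(R :: 'a wgraph) x. config p n R x \<Longrightarrow> config_count q R x \<le> M"
    and R0: "config p n R0 (\<lambda>_. 1)" "config_count q R0 (\<lambda>_. 1) = M" and M: "0 \<le> M"
    using obtain_max_config_count[OF assms(4) p, of q] unfolding assms(5) by metis
  \<comment> \<open>Unit sizes turn a graph on any \<open>n\<close> vertices into a configuration,
    so \<open>M\<close> bounds all competitors, not only those on \<open>V\<close>.\<close>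
  have le: "clique_count q R \<le> M" if "weighted_graph R" "card (verts R) = n" "skeleton_free p R"
    for R :: "'a wgraph"
    using max[of R "\<lambda>_. 1"] that by (simp add: config_def clique_count_eq_vcount)
  have ?thesis if "verts R = V" "weighted_graph R" "skeleton_free p R" "M \<le> clique_count q R"
    "profile_graph R" for R :: "'a wgraph"
    using that le assms(5) by (intro exI[of _ R]) (fastforce simp: is_arg_max_def)
  note reduce = this
  show ?thesis
  \<comment> \<open>The locale needs a positive maximum. When it is 0, any nonnegative count is
    maximal.\<close>
  proof (cases "M = 0")
    case True
    show ?thesis
      using independent_graph[OF assms(4) p] True
      by (intro reduce[of "independent_graph V"]) (auto simp: independent_graph_def)
  next
    case False
    interpret optimum p n r M "TYPE('a)"
      by unfold_locales (use M False max q in auto)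
    obtain R x where opt: "optimal R x" and twins:
      "\<And>i j. i \<in> verts R \<Longrightarrow> j \<in> verts R \<Longrightarrow> i \<noteq> j \<Longrightarrow> wt R {i,j} = 1/2 \<Longrightarrow> nbhd R i = nbhd R j"
      using exists_multipartite_optimal[OF R0[unfolded q]] by blast
    have cfg: "config p (card V) R x" and half: "\<And>e. e \<in> [verts R]\<^bsup>2\<^esup> \<Longrightarrow> wt R e \<in> {1/2, 1}"
      and count: "config_count q R x = M"
      using opt assms(5) q by (auto simp: optimal_def)
    obtain \<phi> where \<phi>: "\<phi> ` V \<subseteq> verts R" "\<And>i. i \<in> verts R \<Longrightarrow> card {v\<in>V. \<phi> v = i} = x i"
      "weighted_graph (blowup V \<phi> R)" "skeleton_free p (blowup V \<phi> R)"
      "clique_count q (blowup V \<phi> R) = config_count q R x"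
      using config_blowup[OF cfg assms(4), of q] by blast
    have "x i \<le> x j + 1" if "i \<in> verts R" "j \<in> verts R" "nbhd R i = nbhd R j" for i j
    proof (cases "i = j")
      case False
      then have "wt R {i,j} = 1/2"
        using half[of "{i,j}"] adjacent_nbhd_neq[of i R j] that by auto
      then show ?thesis using twins_balanced[OF opt] that False by blast
    qed simp
    \<comment> \<open>A profile is a nonempty list, so \<open>R\<close> must have a vertex;
      \<open>\<phi>\<close> supplies one from \<open>V\<close>.\<close>
    moreover have "V \<noteq> {}" using assms by auto
    ultimately have "\<exists>s. has_profile s (blowup V \<phi> R)"
      using \<phi>(1) cfg by (intro profile_blowup[OF _ _ \<phi>(1,2) half twins])
        (auto simp: config_def weighted_graph_def)
    then show ?thesis
      using \<phi> count by (intro reduce[of "blowup V \<phi> R"]) (auto simp: profile_graph_def)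
  qed
qed

end
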